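(* Let $X=\{X(t),t\in[0,1]\}$ be an $\mathbb{F}$-adapted process and let $\alpha>\frac12$, $\delta>0$ be constants such that, for some positive constants $C$ (not necessarily the same in (i) and (ii)): (i) for every $s,t\in[0,1]$, $|X(t)-X(s)|\le C|t-s|^{\alpha}$; (ii) for every $s,t\in[1-\delta,1]$ with $t=s+\Delta$, $\Delta>0$, and every $\epsilon>0$ with $\epsilon\le\Delta^{\alpha}$, $$P\Big(\sup_{s\le u\le t}|X(u)-X(s)|\le\epsilon\Big)\le\exp\big(-C\Delta\,\epsilon^{-1/\alpha}\big).$$ Suppose that there exists $v\in(1-\delta,1)$ such that the random variable $X(v)$ has a continuous distribution. Then for any distribution function $F$ on $\mathbb{R}$ there exists an $\mathbb{F}$-adapted process $\varphi$ such that the integral $\int_0^1\varphi(s)\,dX(s)$ exists and has distribution $F$.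
   Context: $(\Omega,\mathcal{F},\mathbb{F}=\{\mathcal{F}_t,t\in[0,1]\},P)$ is a stochastic basis (filtered probability space). Integrals with respect to $X$ are pathwise generalized Lebesgue--Stieltjes integrals, defined as follows. For $f,g:[a,b]\to\mathbb{R}$ and $\beta\in(0,1)$ put $$(D_{a+}^{\beta}f)(x)=\frac{1}{\Gamma(1-\beta)}\Big(\frac{f(x)}{(x-a)^\beta}+\beta\int_a^x\frac{f(x)-f(u)}{(x-u)^{\beta+1}}du\Big),$$ $$(D_{b-}^{1-\beta}g)(x)=\frac{e^{i\pi(1-\beta)}}{\Gamma(\beta)}\Big(\frac{g(x)}{(b-x)^{1-\beta}}+(1-\beta)\int_x^b\frac{g(x)-g(u)}{(u-x)^{2-\beta}}du\Big),$$ and $g_{b-}(x)=g(x)-g(b)$. If $D_{a+}^\beta f\in L_1[a,b]$ and $D_{b-}^{1-\beta}g_{b-}\in L_\infty[a,b]$, then $$\int_a^b f(x)\,dg(x)=e^{i\pi\beta}\int_a^b(D_{a+}^\beta f)(x)(D_{b-}^{1-\beta}g_{b-})(x)\,dx.$$ If $g$ is $\alpha$-H\"older continuous on $[a,b]$, the admissible integrands are the functions $f$ with $$\|f\|_{\beta;[a,b]}=\int_a^b\Big(\frac{|f(t)|}{(t-a)^\beta}+\int_a^t\frac{|f(t)-f(s)|}{(t-s)^{\beta+1}}ds\Big)dt<\infty$$ for some $\beta\in(1-\alpha,1)$; for these the integral is well defined, and "the integral exists" means this (pathwise, almost surely). *)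

theory Defs
  imports "HOL-Probability.Probability"
begin

section \<open>Generalized Lebesgue--Stieltjes integral\<close>

definition frac_deriv_left :: "real \<Rightarrow> real \<Rightarrow> (real \<Rightarrow> real) \<Rightarrow> real \<Rightarrow> real" where
  "frac_deriv_left \<beta> a f x =
     1 / Gamma (1 - \<beta>) *
     (f x / (x - a) powr \<beta>
      + \<beta> * (LINT u|lebesgue_on {a..x}. (f x - f u) / (x - u) powr (\<beta> + 1)))"

text \<open>Stated for a general order \<open>\<gamma>\<close>; the integral below uses \<open>\<gamma> = 1 - \<beta>\<close>,
  for which \<open>Gamma (1 - \<gamma>) = Gamma \<beta>\<close> and \<open>\<gamma> + 1 = 2 - \<beta>\<close>.\<close>

definition frac_deriv_right :: "real \<Rightarrow> real \<Rightarrow> (real \<Rightarrow> real) \<Rightarrow> real \<Rightarrow> complex" where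
  "frac_deriv_right \<gamma> b g x =
     exp (\<i> * complex_of_real (pi * \<gamma>)) / complex_of_real (Gamma (1 - \<gamma>)) *
     complex_of_real (g x / (b - x) powr \<gamma>
      + \<gamma> * (LINT u|lebesgue_on {x..b}. (g x - g u) / (u - x) powr (\<gamma> + 1)))"

definition gls_defined :: "real \<Rightarrow> real \<Rightarrow> real \<Rightarrow> (real \<Rightarrow> real) \<Rightarrow> (real \<Rightarrow> real) \<Rightarrow> bool" where
  "gls_defined \<beta> a b f g \<longleftrightarrow>
     integrable (lebesgue_on {a..b}) (frac_deriv_left \<beta> a f) \<and>
     frac_deriv_right (1 - \<beta>) b (\<lambda>x. g x - g b) \<in> borel_measurable (lebesgue_on {a..b}) \<and>
     (\<exists>K. AE x in lebesgue_on {a..b}. cmod (frac_deriv_right (1 - \<beta>) b (\<lambda>x. g x - g b) x) \<le> K)"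

definition gls_integral :: "real \<Rightarrow> real \<Rightarrow> real \<Rightarrow> (real \<Rightarrow> real) \<Rightarrow> (real \<Rightarrow> real) \<Rightarrow> complex" where
  "gls_integral \<beta> a b f g =
     exp (\<i> * complex_of_real (pi * \<beta>)) *
     (LINT x|lebesgue_on {a..b}.
        complex_of_real (frac_deriv_left \<beta> a f x) *
        frac_deriv_right (1 - \<beta>) b (\<lambda>x. g x - g b) x)"

definition gls_norm :: "real \<Rightarrow> real \<Rightarrow> real \<Rightarrow> (real \<Rightarrow> real) \<Rightarrow> ennreal" where
  "gls_norm \<beta> a b f =
     (\<integral>\<^sup>+ t. ennreal (\<bar>f t\<bar> / (t - a) powr \<beta>)
         + (\<integral>\<^sup>+ s. ennreal (\<bar>f t - f s\<bar> / (t - s) powr (\<beta> + 1)) \<partial>lebesgue_on {a..t})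
      \<partial>lebesgue_on {a..b})"

text \<open>\<open>has_gls_integral \<alpha> a b f g I\<close>: for an \<open>\<alpha>\<close>-Hoelder integrator \<open>g\<close>, the integral of \<open>f\<close>
  with respect to \<open>g\<close> over \<open>[a,b]\<close> exists and equals the real number \<open>I\<close>. Measurability of
  \<open>f\<close> has to be required explicitly, since \<open>nn_integral\<close> is also defined, as a lower integral,
  for non-measurable functions.\<close>

definition has_gls_integral ::
    "real \<Rightarrow> real \<Rightarrow> real \<Rightarrow> (real \<Rightarrow> real) \<Rightarrow> (real \<Rightarrow> real) \<Rightarrow> real \<Rightarrow> bool" where
  "has_gls_integral \<alpha> a b f g I \<longleftrightarrow>
     (\<exists>\<beta>. 0 < \<beta> \<and> 1 - \<alpha> < \<beta> \<and> \<beta> < 1 \<and>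
        f \<in> borel_measurable (lebesgue_on {a..b}) \<and> gls_norm \<beta> a b f < \<infinity> \<and>
        gls_defined \<beta> a b f g \<and> complex_of_real I = gls_integral \<beta> a b f g)"

section \<open>Stochastic bases and distribution functions\<close>

text \<open>Time runs over \<open>[0,1]\<close> only; values of a filtration or process at other indices play no
  role. No completeness or right-continuity of the filtration is assumed.\<close>

definition stochastic_basis :: "'a measure \<Rightarrow> (real \<Rightarrow> 'a measure) \<Rightarrow> bool" where
  "stochastic_basis M \<F> \<longleftrightarrow>
     prob_space M \<and> (\<forall>t\<in>{0..1}. subalgebra M (\<F> t)) \<and>
     (\<forall>s\<in>{0..1}. \<forall>t\<in>{0..1}. s \<le> t \<longrightarrow> sets (\<F> s) \<subseteq> sets (\<F> t))"

definition adapted_process :: "(real \<Rightarrow> 'a measure) \<Rightarrow> (real \<Rightarrow> 'a \<Rightarrow> real) \<Rightarrow> bool" where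
  "adapted_process \<F> X \<longleftrightarrow> (\<forall>t\<in>{0..1}. X t \<in> borel_measurable (\<F> t))"

definition distribution_function :: "(real \<Rightarrow> real) \<Rightarrow> bool" where
  "distribution_function F \<longleftrightarrow>
     mono F \<and> (\<forall>x. continuous (at_right x) F) \<and>
     (F \<longlongrightarrow> 0) at_bot \<and> (F \<longlongrightarrow> 1) at_top"

end

theory Submission
  imports Defs
begin

text \<open>
  The generalized Lebesgue--Stieltjes integral of the indicator of \<open>[0,\<tau>]\<close> against a Hoelder path
  \<open>g\<close> is \<open>g \<tau> - g 0\<close>: up to constants this says that the fractional integral of order \<open>1 - \<beta>\<close>
  inverts the corresponding derivative, which is checked for smooth paths by Fubini's theorem and
  the Beta integral and carried over by regularisation with uniform Hoelder bounds. Hence step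
  functions integrate to the expected sums.

  On a short interval starting at \<open>a\<close>, holding \<open>2 c (X - X a)\<close>, updated along a fine grid, yields
  \<open>c (X u - X a)\<^sup>2\<close> up to \<open>c\<close> times a quadratic variation, which is small since \<open>\<alpha> > 1/2\<close>. By the
  small ball estimate \<open>X\<close> leaves a sufficiently small ball around \<open>X a\<close> with probability close to
  \<open>1\<close>. Taking such intervals \<open>[s n, s (n + 1)]\<close> from \<open>v\<close> up to \<open>1\<close> and suitable \<open>c n\<close>, the running
  integral almost surely exceeds every level before time \<open>1\<close>, after only finitely many steps. For an
  \<open>\<F> v\<close>-measurable \<open>\<xi>\<close>, stop at the first time \<open>\<tau>\<close> when the level \<open>|\<xi>|\<close> is about to be exceeded
  and multiply by the sign of \<open>\<xi>\<close>: the integral is \<open>\<xi>\<close>. Finally \<open>\<xi>\<close> may be given the distribution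
  \<open>F\<close> as a quantile transform of \<open>X v\<close>.
\<close>

section \<open>Integrals of powers over bounded intervals\<close>

lemma integrable_abs_le:
  fixes f g :: "'a \<Rightarrow> real"
  assumes "integrable M g" "f \<in> borel_measurable M" "\<And>x. \<bar>f x\<bar> \<le> g x"
  shows "integrable M f"
proof (rule Bochner_Integration.integrable_bound[OF assms(1,2)])
  have "\<bar>f x\<bar> \<le> \<bar>g x\<bar>" for x using assms(3)[of x] by linarith
  then show "AE x in M. norm (f x) \<le> norm (g x)" by simp
qed

text \<open>Nonnegativity turns a gauge integral into a Lebesgue integral, so that powers with end
  point singularities come with their integrability and their value at once.\<close>

lemma has_bochner_integral_Icc_nonneg:
  fixes f :: "real \<Rightarrow> real"
  assumes "f \<in> borel_measurable borel" "(f has_integral I) {a..b}" "\<And>x. x \<in> {a..b} \<Longrightarrow> 0 \<le> f x"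
  shows "has_bochner_integral lborel (\<lambda>x. indicator {a..b} x * f x) I"
proof -
  have *: "((\<lambda>x. indicator {a..b} x * f x) has_integral I) UNIV"
    using assms(2) unfolding has_integral_restrict_UNIV[of "{a..b}" f, symmetric]
    by (rule has_integral_eq[rotated]) (auto simp: indicator_def)
  have nn: "0 \<le> indicator {a..b} x * f x" for x
    using assms(3)[of x] by (auto simp: indicator_def)
  have "0 \<le> I" using assms(2,3) by (rule has_integral_nonneg)
  moreover have "(\<integral>\<^sup>+ x. ennreal (indicator {a..b} x * f x) \<partial>lborel) = ennreal I"
    using assms(1) nn * by (intro nn_integral_has_integral_lborel) auto
  ultimately show ?thesis
    using assms(1) nn by (intro has_bochner_integral_nn_integral) auto
qed

lemma has_bochner_integral_powr_left:
  fixes a b p :: real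
  assumes "a \<le> b" "p > -1"
  shows "has_bochner_integral lborel (\<lambda>u. indicator {a..b} u * (u - a) powr p) ((b - a) powr (p + 1) / (p + 1))"
proof -
  have *: "has_bochner_integral lborel (\<lambda>u. indicator {0..b-a} u * u powr p) ((b - a) powr (p + 1) / (p + 1))"
    using assms by (intro has_bochner_integral_Icc_nonneg has_integral_powr_from_0) auto
  show ?thesis
    using iffD1[OF lborel_has_bochner_integral_real_affine_iff[where c=1 and t="-a"] *]
    by (simp add: indicator_def atLeastAtMost_iff algebra_simps cong: if_cong)
qed

text \<open>The substitution t = (x - a) / (b - a) leads to the Beta integral over [0,1]. The
  exponents add up to -1, so the length of the interval cancels and the value is the same for all a
  < b; the inversion below rests on this.\<close>

lemma has_bochner_integral_Beta_Icc:
  fixes a b \<beta> :: real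
  assumes "a < b" "0 < \<beta>" "\<beta> < 1"
  shows "has_bochner_integral lborel
    (\<lambda>x. indicator {a..b} x * ((x - a) powr (- \<beta>) * (b - x) powr (\<beta> - 1))) (Beta (1 - \<beta>) \<beta>)"
proof -
  let ?f = "\<lambda>t::real. indicator {0..1} t * (t powr (1 - \<beta> - 1) * (1 - t) powr (\<beta> - 1))"
  have *: "has_bochner_integral lborel ?f (Beta (1 - \<beta>) \<beta>)"
    using assms by (intro has_bochner_integral_Icc_nonneg has_integral_Beta_real) auto
  have c: "1 / (b - a) \<noteq> 0" using assms by auto
  have eq: "?f (- a / (b - a) + 1 / (b - a) * x) =
    (b - a) * (indicator {a..b} x * ((x - a) powr (- \<beta>) * (b - x) powr (\<beta> - 1)))" for x
  proof -
    have 1: "- a / (b - a) + 1 / (b - a) * x = (x - a) / (b - a)"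
      by (simp add: diff_divide_distrib)
    have 2: "1 - (x - a) / (b - a) = (b - x) / (b - a)"
      using assms by (simp add: field_simps)
    have 3: "(b - a) powr (- \<beta>) * (b - a) powr (\<beta> - 1) = 1 / (b - a)"
      using powr_add[of "b - a" "- \<beta>" "\<beta> - 1"] powr_minus_divide[of "b - a" 1] assms by simp
    have 4: "(x - a) / (b - a) \<in> {0..1} \<longleftrightarrow> x \<in> {a..b}"
      using assms by (auto simp: field_simps)
    have "((x - a) / (b - a)) powr (- \<beta>) * ((b - x) / (b - a)) powr (\<beta> - 1) =
      (b - a) * ((x - a) powr (- \<beta>) * (b - x) powr (\<beta> - 1))" if "x \<in> {a..b}"
    proof -
      have "((x - a) / (b - a)) powr (- \<beta>) * ((b - x) / (b - a)) powr (\<beta> - 1) =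
        ((x - a) powr (- \<beta>) * (b - x) powr (\<beta> - 1)) / ((b - a) powr (- \<beta>) * (b - a) powr (\<beta> - 1))"
        using that assms by (simp add: powr_divide)
      then show ?thesis unfolding 3 by simp
    qed
    then show ?thesis unfolding 1 2 using 4 by (auto simp: indicator_def)
  qed
  have "has_bochner_integral lborel
     (\<lambda>x. (b - a) * (indicator {a..b} x * ((x - a) powr (- \<beta>) * (b - x) powr (\<beta> - 1))))
     ((b - a) * Beta (1 - \<beta>) \<beta>)"
    using iffD1[OF lborel_has_bochner_integral_real_affine_iff[OF c, where t="-a/(b-a)"] *] assms
    unfolding eq by (simp add: mult.commute)
  from has_bochner_integral_mult_right[OF this, of "1 / (b - a)"] show ?thesis
    using assms by simp
qed

section \<open>The right-sided fractional derivative and its inversion\<close>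

text \<open>For \<open>h\<close> with \<open>h 1 = 0\<close>, this is \<open>Gamma \<beta>\<close> times the derivative of order \<open>1 - \<beta>\<close> at the
  right end point \<open>1\<close>, without the factor \<open>exp (\<i> \<pi> (1 - \<beta>))\<close>.\<close>

definition right_marchaud :: "real \<Rightarrow> (real \<Rightarrow> real) \<Rightarrow> real \<Rightarrow> real" where
  "right_marchaud \<beta> h x = h x * (1 - x) powr (\<beta> - 1)
     + (1 - \<beta>) * (LINT u|lborel. indicator {x..1} u * ((h x - h u) * (u - x) powr (\<beta> - 2)))"

text \<open>The Hoelder bound on \<open>h x - h u\<close> weakens the singularity from order \<beta>
  - 2 to \<alpha> + \<beta> - 2, which exceeds -1 because 1 - \<alpha> < \<beta>. The pointwise
  bound serves later as a dominating function.\<close>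

lemma right_marchaud_integrable:
  fixes h :: "real \<Rightarrow> real"
  assumes h: "h \<in> borel_measurable borel" "\<And>s t. \<bar>h t - h s\<bar> \<le> C * \<bar>t - s\<bar> powr \<alpha>"
    and "1 - \<alpha> < \<beta>" and x: "x \<le> 1"
  shows "\<bar>indicator {x..1} u * ((h x - h u) * (u - x) powr (\<beta> - 2))\<bar>
           \<le> C * (indicator {x..1} u * (u - x) powr (\<alpha> + \<beta> - 2))"
    and "integrable lborel (\<lambda>u. indicator {x..1} u * ((h x - h u) * (u - x) powr (\<beta> - 2)))"
    and "\<bar>LINT u|lborel. indicator {x..1} u * ((h x - h u) * (u - x) powr (\<beta> - 2))\<bar>
           \<le> C * ((1 - x) powr (\<alpha> + \<beta> - 1) / (\<alpha> + \<beta> - 1))"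
proof -
  let ?k = "\<lambda>u. indicator {x..1} u * ((h x - h u) * (u - x) powr (\<beta> - 2))"
  have le: "\<bar>?k u\<bar> \<le> C * (indicator {x..1} u * (u - x) powr (\<alpha> + \<beta> - 2))" for u
  proof (cases "u \<in> {x..1}")
    case True
    have "\<bar>h x - h u\<bar> * (u - x) powr (\<beta> - 2) \<le> (C * (u - x) powr \<alpha>) * (u - x) powr (\<beta> - 2)"
      using h(2)[of u x] True by (intro mult_right_mono) (auto simp: abs_minus_commute)
    also have "\<dots> = C * (u - x) powr (\<alpha> + \<beta> - 2)"
      by (simp add: powr_add[symmetric] algebra_simps)
    finally show ?thesis using True by (simp add: abs_mult)
  qed auto
  then show "\<bar>?k u\<bar> \<le> C * (indicator {x..1} u * (u - x) powr (\<alpha> + \<beta> - 2))" .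
  have dom: "has_bochner_integral lborel (\<lambda>u. C * (indicator {x..1} u * (u - x) powr (\<alpha> + \<beta> - 2)))
      (C * ((1 - x) powr (\<alpha> + \<beta> - 1) / (\<alpha> + \<beta> - 1)))"
    using has_bochner_integral_powr_left[of x 1 "\<alpha> + \<beta> - 2"] assms
    by (intro has_bochner_integral_mult_right) (simp add: algebra_simps)
  have [measurable]: "h \<in> borel_measurable borel" by fact
  show int: "integrable lborel ?k"
    by (rule integrable_abs_le[OF integrable.intros[OF dom]]) (measurable, rule le)
  have "\<bar>integral\<^sup>L lborel ?k\<bar> \<le> (LINT u|lborel. \<bar>?k u\<bar>)"
    by (rule integral_abs_bound)
  also have "\<dots> \<le> (LINT u|lborel. C * (indicator {x..1} u * (u - x) powr (\<alpha> + \<beta> - 2)))"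
    using int le by (intro integral_mono integrable_abs integrable.intros[OF dom]) auto
  also have "\<dots> = C * ((1 - x) powr (\<alpha> + \<beta> - 1) / (\<alpha> + \<beta> - 1))"
    using dom by (rule has_bochner_integral_integral_eq)
  finally show "\<bar>integral\<^sup>L lborel ?k\<bar> \<le> C * ((1 - x) powr (\<alpha> + \<beta> - 1) / (\<alpha> + \<beta> - 1))" .
qed

text \<open>Integration by parts: the derivative in u of (h x - h u) (u - x)^(\<beta> - 1) consists
  of the two integrands, and since \<open>h 1 = 0\<close> its boundary value at 1 is the first term
  of \<open>right_marchaud\<close>.\<close>

lemma right_marchaud_smooth:
  fixes h h' :: "real \<Rightarrow> real"
  assumes der: "\<And>x. (h has_real_derivative h' x) (at x)"
    and h': "h' \<in> borel_measurable borel" "\<And>x. \<bar>h' x\<bar> \<le> L" and h1: "h 1 = 0"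
    and \<beta>: "0 < \<beta>" "\<beta> < 1" and x: "x \<le> 1"
  shows "integrable lborel (\<lambda>u. indicator {x..1} u * (h' u * (u - x) powr (\<beta> - 1)))" (is "integrable _ ?k1")
    and "right_marchaud \<beta> h x = - (LINT u|lborel. indicator {x..1} u * (h' u * (u - x) powr (\<beta> - 1)))"
proof -
  have [measurable]: "h' \<in> borel_measurable borel" by fact
  have cont: "continuous_on UNIV h"
    by (intro continuous_at_imp_continuous_on ballI DERIV_isCont[OF der])
  then have hm: "h \<in> borel_measurable borel" by (rule borel_measurable_continuous_onI)
  have lip: "\<bar>h t - h s\<bar> \<le> L * \<bar>t - s\<bar>" for s t
  proof -
    have "norm (h t - h s) \<le> L * norm (t - s)"
      using der h'(2) by (intro field_differentiable_bound[where S=UNIV and f'=h']) auto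
    then show ?thesis by simp
  qed
  have hoel: "\<bar>h t - h s\<bar> \<le> L * \<bar>t - s\<bar> powr 1" for s t
    using lip[of t s] by (cases "s = t") auto
  let ?k2 = "\<lambda>u. indicator {x..1} u * ((h x - h u) * (u - x) powr (\<beta> - 2))"
  have i2: "integrable lborel ?k2"
    using right_marchaud_integrable(2)[OF hm hoel _ x, of \<beta>] \<beta> by simp
  have dom: "integrable lborel (\<lambda>u. L * (indicator {x..1} u * (u - x) powr (\<beta> - 1)))"
    using has_bochner_integral_powr_left[of x 1 "\<beta> - 1"] \<beta> x
    by (intro integrable_mult_right) (auto simp: has_bochner_integral_iff)
  show i1: "integrable lborel ?k1"
  proof (rule integrable_abs_le[OF dom])
    show "\<bar>?k1 u\<bar> \<le> L * (indicator {x..1} u * (u - x) powr (\<beta> - 1))" for u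
      using h'(2)[of u] by (auto simp: abs_mult indicator_def intro!: mult_right_mono)
  qed measurable
  show "right_marchaud \<beta> h x = - integral\<^sup>L lborel ?k1"
  proof -
    let ?F = "\<lambda>u. (h x - h u) * (u - x) powr (\<beta> - 1)"
    have contF: "continuous_on {x..1} ?F"
    proof (rule continuous_on_eq_continuous_within[THEN iffD2], rule ballI)
      fix u assume u: "u \<in> {x..1}"
      show "continuous (at u within {x..1}) ?F"
      proof (cases "u = x")
        case False
        have "continuous (at u within {x..1}) h"
          using cont by (simp add: continuous_on_eq_continuous_at continuous_at_imp_continuous_at_within)
        then show ?thesis using u False by (intro continuous_intros) auto
      next
        case True
        \<comment> \<open>At the end point \<open>x\<close> the power is singular, but the Lipschitz
          bound leaves a multiple of (w - x)^\<beta>, which tends to 0.\<close>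
        have bnd: "norm (?F w) \<le> L * (w - x) powr \<beta>" if "w \<in> {x..1}" for w
        proof (cases "w = x")
          case False
          have "\<bar>h x - h w\<bar> * (w - x) powr (\<beta> - 1) \<le> (L * (w - x)) * (w - x) powr (\<beta> - 1)"
            using lip[of w x] that by (intro mult_right_mono) (auto simp: abs_minus_commute)
          also have "\<dots> = L * (w - x) powr \<beta>"
            using False that by (simp add: powr_diff)
          finally show ?thesis by (simp add: abs_mult)
        qed simp
        have "((\<lambda>w. L * (w - x) powr \<beta>) \<longlongrightarrow> L * (x - x) powr \<beta>) (at x within {x..1})"
          using \<beta> by (intro tendsto_intros) (auto simp: eventually_at_filter)
        then have z: "((\<lambda>w. L * (w - x) powr \<beta>) \<longlongrightarrow> 0) (at x within {x..1})" using \<beta> by simp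
        have "(?F \<longlongrightarrow> 0) (at x within {x..1})"
          by (rule Lim_null_comparison[OF _ z]) (use bnd in \<open>simp add: eventually_at_filter always_eventually\<close>)
        then show ?thesis unfolding True continuous_within by simp
      qed
    qed
    have derF: "(?F has_vector_derivative
        (- (h' u * (u - x) powr (\<beta> - 1)) + (\<beta> - 1) * ((h x - h u) * (u - x) powr (\<beta> - 2)))) (at u)"
      if "u \<in> {x<..<1}" for u
    proof -
      have "((\<lambda>u. (u - x) powr (\<beta> - 1)) has_real_derivative (\<beta> - 1) * (u - x) powr (\<beta> - 2)) (at u)"
        using that by (auto intro!: derivative_eq_intros)
      from DERIV_mult[OF DERIV_diff[OF DERIV_const der] this, of "h x"]
      show ?thesis
        unfolding has_real_derivative_iff_has_vector_derivative by (simp add: algebra_simps)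
    qed
    have "((\<lambda>u. - (h' u * (u - x) powr (\<beta> - 1)) + (\<beta> - 1) * ((h x - h u) * (u - x) powr (\<beta> - 2)))
        has_integral (?F 1 - ?F x)) {x..1}"
      using x contF derF by (rule fundamental_theorem_of_calculus_interior)
    then have "((\<lambda>u. if u \<in> {x..1} then - (h' u * (u - x) powr (\<beta> - 1)) + (\<beta> - 1) * ((h x - h u) * (u - x) powr (\<beta> - 2)) else 0)
        has_integral (h x * (1 - x) powr (\<beta> - 1))) UNIV"
      unfolding has_integral_restrict_UNIV h1 by simp
    then have A: "((\<lambda>u. - ?k1 u + (\<beta> - 1) * ?k2 u) has_integral (h x * (1 - x) powr (\<beta> - 1))) UNIV"
      by (rule has_integral_eq[rotated]) (auto simp: indicator_def)
    \<comment> \<open>The Lebesgue integrals are read as gauge integrals, whose uniqueness equates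
      them with the boundary term.\<close>
    have B: "((\<lambda>u. - ?k1 u + (\<beta> - 1) * ?k2 u) has_integral
        (- integral\<^sup>L lborel ?k1 + (\<beta> - 1) * integral\<^sup>L lborel ?k2)) UNIV"
      by (intro has_integral_add has_integral_neg has_integral_mult_right has_integral_integral_lborel i1 i2)
    show ?thesis
      using has_integral_unique[OF A B] unfolding right_marchaud_def by (simp add: algebra_simps)
  qed
qed

text \<open>Insert \<open>right_marchaud_smooth\<close> and exchange the integrals over the triangle
  a \<le> x \<le> u \<le> 1. For fixed u the integral in x is the Beta integral over [a,u], a
  constant, and what remains is the integral of -h' over [a,1], that is \<open>h a\<close>.\<close>

lemma right_marchaud_inversion_smooth:
  fixes h h' :: "real \<Rightarrow> real"
  assumes der: "\<And>x. (h has_real_derivative h' x) (at x)"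
    and h': "continuous_on UNIV h'" "\<And>x. \<bar>h' x\<bar> \<le> L" and h1: "h 1 = 0"
    and \<beta>: "0 < \<beta>" "\<beta> < 1" and a: "a \<le> 1"
  shows "(LINT x|lborel. indicator {a..1} x * ((x - a) powr (- \<beta>) * right_marchaud \<beta> h x))
     = Beta (1 - \<beta>) \<beta> * h a"
proof -
  have h'm[measurable]: "h' \<in> borel_measurable borel" using h'(1) by (rule borel_measurable_continuous_onI)
  let ?B = "Beta (1 - \<beta>) \<beta>"
  define f where "f u x = indicator {a..1} u * (h' u * (indicator {a..u} x * ((x - a) powr (- \<beta>) * (u - x) powr (\<beta> - 1))))"
    for u x :: real
  have fm: "(\<lambda>(u, x). f u x) \<in> borel_measurable (lborel \<Otimes>\<^sub>M lborel)"
  proof -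
    have "f u x = (if a \<le> u \<and> u \<le> 1 then h' u * (if a \<le> x \<and> x \<le> u then ((x - a) powr (- \<beta>) * (u - x) powr (\<beta> - 1)) else 0) else 0)" for u x
      by (auto simp: f_def indicator_def)
    then show ?thesis by simp
  qed
  \<comment> \<open>For \<open>u = a\<close> the inner interval is a point and its integral is 0
    instead of the Beta value; hence the half-open \<open>{a<..1}\<close>.\<close>
  have inner: "has_bochner_integral lborel (f u) (indicator {a<..1} u * (h' u * ?B))" for u
  proof (cases "u \<in> {a<..1}")
    case True
    then show ?thesis unfolding f_def using has_bochner_integral_Beta_Icc[of a u \<beta>] \<beta>
      by (auto intro!: has_bochner_integral_mult_right)
  next
    case False
    then have "f u x = 0" for x by (auto simp: f_def indicator_def)
    then have "f u = (\<lambda>x. 0)" by auto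
    then show ?thesis using False by (simp add: has_bochner_integral_zero)
  qed
  have norm_f: "norm (f u x) = indicator {a..1} u * (\<bar>h' u\<bar> * (indicator {a..u} x * ((x - a) powr (- \<beta>) * (u - x) powr (\<beta> - 1))))"
    for u x by (auto simp: f_def abs_mult indicator_def)
  have inner_norm: "(LINT x|lborel. norm (f u x)) = indicator {a<..1} u * (\<bar>h' u\<bar> * ?B)" for u
  proof (cases "u \<in> {a<..1}")
    case True
    then show ?thesis unfolding norm_f using has_bochner_integral_Beta_Icc[of a u \<beta>] \<beta>
      by (auto simp: has_bochner_integral_iff)
  next
    case False
    then have "f u x = 0" for x by (auto simp: f_def indicator_def)
    then show ?thesis using False by simp
  qed
  have Bnn: "0 \<le> ?B"
    unfolding has_bochner_integral_integral_eq[OF has_bochner_integral_Beta_Icc[of 0 1 \<beta>, simplified, OF \<beta>], symmetric]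
    by (rule Bochner_Integration.integral_nonneg) auto
  have int: "integrable (lborel \<Otimes>\<^sub>M lborel) (\<lambda>(u, x). f u x)"
  proof (rule lborel_pair.Fubini_integrable[OF fm])
    have "integrable lborel (\<lambda>u. indicator {a<..1} u * (\<bar>h' u\<bar> * ?B))"
    proof (rule integrable_abs_le[of _ "\<lambda>u. indicator {a<..1} u * (L * ?B)"])
      show "integrable lborel (\<lambda>u::real. indicator {a<..1} u * (L * ?B))"
        by (intro integrable_mult_left) (simp add: a)
      show "\<bar>indicator {a<..1} u * (\<bar>h' u\<bar> * ?B)\<bar> \<le> indicator {a<..1} u * (L * ?B)" for u
        using h'(2) Bnn by (auto simp: indicator_def abs_mult intro!: mult_right_mono)
    qed measurable
    then show "integrable lborel (\<lambda>u. LINT x|lborel. norm (case (u, x) of (u, x) \<Rightarrow> f u x))"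
      unfolding split_conv inner_norm .
    show "AE u in lborel. integrable lborel (\<lambda>x. case (u, x) of (u, x) \<Rightarrow> f u x)"
      using inner by (auto simp: has_bochner_integral_iff)
  qed
  have "indicator {a..1} x * ((x - a) powr (- \<beta>) * right_marchaud \<beta> h x) = - (LINT u|lborel. f u x)" for x
  proof (cases "x \<in> {a..1}")
    case True
    have "f u x = (x - a) powr (- \<beta>) * (indicator {x..1} u * (h' u * (u - x) powr (\<beta> - 1)))" for u
      using True by (auto simp: f_def indicator_def)
    then show ?thesis using True right_marchaud_smooth[OF der h'm h'(2) h1 \<beta>, of x] by simp
  next
    case False
    then have "f u x = 0" for u by (auto simp: f_def indicator_def)
    then show ?thesis using False by simp
  qed
  then have "(LINT x|lborel. indicator {a..1} x * ((x - a) powr (- \<beta>) * right_marchaud \<beta> h x))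
    = - (LINT x|lborel. (LINT u|lborel. f u x))" by simp
  also have "(LINT x|lborel. (LINT u|lborel. f u x)) = (LINT u|lborel. (LINT x|lborel. f u x))"
    using lborel_pair.Fubini_integral[OF int] .
  also have "\<dots> = (LINT u|lborel. indicator {a<..1} u * (h' u * ?B))"
    using inner by (simp add: has_bochner_integral_iff)
  also have "\<dots> = (LINT u|lborel. (indicator {a..1} u *\<^sub>R h' u) * ?B)"
  proof (rule integral_cong_AE)
    show "AE u in lborel. indicator {a<..1} u * (h' u * ?B) = (indicator {a..1} u *\<^sub>R h' u) * ?B"
      using AE_lborel_singleton[of a] by eventually_elim (auto simp: indicator_def)
  qed auto
  also have "\<dots> = (LINT u|lborel. (indicator {a..1} u *\<^sub>R h' u)) * ?B" by simp
  also have "(LINT u|lborel. (indicator {a..1} u *\<^sub>R h' u)) = h 1 - h a"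
    using der h'(1) a by (intro integral_FTC_Icc)
      (auto simp: has_real_derivative_iff_has_vector_derivative
         intro: has_vector_derivative_at_within continuous_on_subset)
  finally show ?thesis using h1 by simp
qed

lemma borel_measurable_right_marchaud [measurable]:
  assumes [measurable]: "h \<in> borel_measurable borel"
  shows "right_marchaud \<beta> h \<in> borel_measurable borel"
proof -
  \<comment> \<open>The domain \<open>{x..1}\<close> moves with x; written as a condition on the
    pair it leaves an integrand whose joint measurability is evident.\<close>
  have eq: "right_marchaud \<beta> h = (\<lambda>x. h x * (1 - x) powr (\<beta> - 1)
      + (1 - \<beta>) * (LINT u|lborel. (if x \<le> u \<and> u \<le> 1 then (h x - h u) * (u - x) powr (\<beta> - 2) else 0)))"
    unfolding right_marchaud_def[abs_def]
    by (intro ext arg_cong2[where f="(+)"] arg_cong2[where f="(*)"] refl Bochner_Integration.integral_cong)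
       (simp add: indicator_def)
  show ?thesis unfolding eq by measurable
qed

text \<open>As \<open>h 1 = 0\<close>, the Hoelder estimate controls the boundary term as well. The
  bound depends on \<open>h\<close> only through \<open>C\<close>, hence holds uniformly along
  approximations that keep this constant.\<close>

lemma right_marchaud_bound:
  fixes h :: "real \<Rightarrow> real"
  assumes h: "h \<in> borel_measurable borel" "\<And>s t. \<bar>h t - h s\<bar> \<le> C * \<bar>t - s\<bar> powr \<alpha>" "h 1 = 0"
    and \<beta>: "1 - \<alpha> < \<beta>" "\<beta> < 1" and x: "x \<le> 1"
  shows "\<bar>right_marchaud \<beta> h x\<bar> \<le> C * (1 + (1 - \<beta>) / (\<alpha> + \<beta> - 1)) * (1 - x) powr (\<alpha> + \<beta> - 1)"
proof -
  have "\<bar>h x * (1 - x) powr (\<beta> - 1)\<bar> \<le> C * (1 - x) powr \<alpha> * (1 - x) powr (\<beta> - 1)"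
    using h(2)[of x 1] h(3) x by (auto simp: abs_mult intro!: mult_right_mono)
  also have "\<dots> = C * (1 - x) powr (\<alpha> + \<beta> - 1)"
    by (simp add: powr_add[symmetric] algebra_simps)
  finally have 1: "\<bar>h x * (1 - x) powr (\<beta> - 1)\<bar> \<le> C * (1 - x) powr (\<alpha> + \<beta> - 1)" .
  have 2: "\<bar>(1 - \<beta>) * (LINT u|lborel. indicator {x..1} u * ((h x - h u) * (u - x) powr (\<beta> - 2)))\<bar>
      \<le> (1 - \<beta>) * (C * ((1 - x) powr (\<alpha> + \<beta> - 1) / (\<alpha> + \<beta> - 1)))"
    unfolding abs_mult using right_marchaud_integrable(3)[OF h(1,2) \<beta>(1) x] \<beta> by (intro mult_mono) auto
  show ?thesis unfolding right_marchaud_def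
    using abs_triangle_ineq[THEN order_trans, OF add_mono[OF 1 2]] by (simp add: algebra_simps)
qed

section \<open>Passage from smooth to Hoelder paths\<close>

lemma hoelder_continuous_measurable:
  fixes h :: "real \<Rightarrow> real"
  assumes h: "\<And>s t. \<bar>h t - h s\<bar> \<le> C * \<bar>t - s\<bar> powr \<alpha>" and \<alpha>: "0 < \<alpha>"
  shows "continuous_on UNIV h" "h \<in> borel_measurable borel"
proof -
  have "isCont h x" for x
  proof -
    have "((\<lambda>t. C * \<bar>t - x\<bar> powr \<alpha>) \<longlongrightarrow> C * \<bar>x - x\<bar> powr \<alpha>) (at x)"
      using \<alpha> by (intro tendsto_intros) (auto simp: eventually_at_filter)
    then have z: "((\<lambda>t. C * \<bar>t - x\<bar> powr \<alpha>) \<longlongrightarrow> 0) (at x)" using \<alpha> by simp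
    have "((\<lambda>t. h t - h x) \<longlongrightarrow> 0) (at x)"
      by (rule Lim_null_comparison[OF _ z]) (use h in \<open>simp add: always_eventually\<close>)
    then show ?thesis unfolding isCont_def by (rule LIM_zero_cancel)
  qed
  then show "continuous_on UNIV h" by (simp add: continuous_at_imp_continuous_on)
  then show "h \<in> borel_measurable borel" by (rule borel_measurable_continuous_onI)
qed

text \<open>The approximations are the Steklov averages over \<open>[x, x + 1 / (n + 1)]\<close>: these keep the
  Hoelder constant, and averaging to the right also keeps the value \<open>0\<close> at \<open>1\<close>.\<close>

lemma hoelder_smooth_approximation:
  fixes h :: "real \<Rightarrow> real"
  assumes hoelder: "\<And>s t. \<bar>h t - h s\<bar> \<le> C * \<bar>t - s\<bar> powr \<alpha>"
    and \<alpha>: "0 < \<alpha>" and zero: "\<And>x. 1 \<le> x \<Longrightarrow> h x = 0"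
  obtains hn hn' :: "nat \<Rightarrow> real \<Rightarrow> real" and L :: "nat \<Rightarrow> real" where
    "\<And>n x. (hn n has_real_derivative hn' n x) (at x)"
    "\<And>n. continuous_on UNIV (hn' n)"
    "\<And>n x. \<bar>hn' n x\<bar> \<le> L n"
    "\<And>n. hn n 1 = 0"
    "\<And>n s t. \<bar>hn n t - hn n s\<bar> \<le> C * \<bar>t - s\<bar> powr \<alpha>"
    "\<And>x. (\<lambda>n. hn n x) \<longlonglongrightarrow> h x"
proof -
  have C: "0 \<le> C" using hoelder[of 1 0] by simp
  have contU: "continuous_on UNIV h" by (rule hoelder_continuous_measurable(1)[OF hoelder \<alpha>])
  then have cont: "isCont h x" for x by (simp add: continuous_on_eq_continuous_at)
  obtain H where "\<And>x. (H has_vector_derivative h x) (at x)"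
    using einterval_antiderivative[of "-\<infinity>" "\<infinity>" h] cont by auto
  then have H: "(H has_real_derivative h x) (at x)" for x
    by (simp add: has_real_derivative_iff_has_vector_derivative)
  define d where "d n = 1 / (real n + 1)" for n
  have d: "0 < d n" for n by (simp add: d_def)
  define hn where "hn n x = (H (x + d n) - H x) / d n" for n x
  define hn' where "hn' n x = (h (x + d n) - h x) / d n" for n x
  \<comment> \<open>Every average is a value of \<open>h\<close> inside the averaging window; this
    yields both the zero at 1 and the distance to \<open>h\<close>.\<close>
  have mean: "\<exists>y. x < y \<and> y < x + d n \<and> hn n x = h y" for n x
    using MVT2[of x "x + d n" H h] H d[of n] by (auto simp: hn_def)
  show thesis
  proof
    show "(hn n has_real_derivative hn' n x) (at x)" for n x
      unfolding hn_def[abs_def] hn'_def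
      by (intro DERIV_cdivide DERIV_diff H DERIV_shift[THEN iffD1])
    show "continuous_on UNIV (hn' n)" for n
      unfolding hn'_def[abs_def] using contU d[of n]
      by (intro continuous_intros continuous_on_compose2[OF contU]) auto
    show "\<bar>hn' n x\<bar> \<le> C * d n powr \<alpha> / d n" for n x
      using hoelder[of "x + d n" x] d[of n] by (simp add: hn'_def divide_right_mono)
    show "hn n 1 = 0" for n using mean[of 1 n] zero by auto
    show "\<bar>hn n t - hn n s\<bar> \<le> C * \<bar>t - s\<bar> powr \<alpha>" for n s t
    proof -
      \<comment> \<open>The mean value theorem is applied to the difference of the two averages as a
        function of the common shift \<open>w\<close>. Both points are then moved by the same
        amount, and the Hoelder constant survives.\<close>
      have "((\<lambda>w. H (t + w) - H (s + w)) has_real_derivative (h (t + w) - h (s + w))) (at w)" for w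
        using DERIV_shift[THEN iffD1, OF H[of "w + t"]] DERIV_shift[THEN iffD1, OF H[of "w + s"]]
        by (auto intro!: DERIV_diff simp: add.commute)
      then obtain w where "H (t + d n) - H (s + d n) - (H (t + 0) - H (s + 0)) = (d n - 0) * (h (t + w) - h (s + w))"
        using MVT2[of 0 "d n" "\<lambda>w. H (t + w) - H (s + w)" "\<lambda>w. h (t + w) - h (s + w)"] d[of n] by auto
      moreover have "hn n t - hn n s = (H (t + d n) - H (s + d n) - (H (t + 0) - H (s + 0))) / d n"
        by (simp add: hn_def diff_divide_distrib)
      ultimately have "hn n t - hn n s = h (t + w) - h (s + w)"
        using d[of n] by simp
      then show ?thesis using hoelder[of "t + w" "s + w"] by simp
    qed
    show "(\<lambda>n. hn n x) \<longlonglongrightarrow> h x" for x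
    proof -
      have dlim: "d \<longlonglongrightarrow> 0" unfolding d_def[abs_def] using LIMSEQ_inverse_real_of_nat
        by (simp add: inverse_eq_divide add.commute)
      have "(\<lambda>n. C * d n powr \<alpha>) \<longlonglongrightarrow> C * 0 powr \<alpha>"
        using \<alpha> d by (intro tendsto_intros dlim) (auto simp: less_imp_le)
      then have z: "(\<lambda>n. C * d n powr \<alpha>) \<longlonglongrightarrow> 0" using \<alpha> by simp
      have "\<bar>hn n x - h x\<bar> \<le> C * d n powr \<alpha>" for n
      proof -
        obtain y where y: "x < y" "y < x + d n" "hn n x = h y" using mean by blast
        have "\<bar>h y - h x\<bar> \<le> C * \<bar>y - x\<bar> powr \<alpha>" by (rule hoelder)
        also have "\<dots> \<le> C * d n powr \<alpha>" using y C \<alpha> by (intro mult_left_mono powr_mono2) auto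
        finally show ?thesis using y by simp
      qed
      then have "(\<lambda>n. hn n x - h x) \<longlonglongrightarrow> 0"
        by (intro Lim_null_comparison[OF _ z]) (simp add: always_eventually)
      then show ?thesis by (rule LIM_zero_cancel)
    qed
  qed
qed

text \<open>The smooth case passes to the limit by dominated convergence, used first for the inner
  integral at fixed x and then for the outer one; both dominating functions depend only on the
  common Hoelder constant.\<close>

lemma right_marchaud_inversion:
  fixes h :: "real \<Rightarrow> real"
  assumes hm: "h \<in> borel_measurable borel"
    and hoelder: "\<And>s t. \<bar>h t - h s\<bar> \<le> C * \<bar>t - s\<bar> powr \<alpha>"
    and zero: "\<And>x. 1 \<le> x \<Longrightarrow> h x = 0"
    and \<alpha>: "0 < \<alpha>" and \<beta>: "0 < \<beta>" "1 - \<alpha> < \<beta>" "\<beta> < 1" and a: "a \<le> 1"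
  shows "has_bochner_integral lborel (\<lambda>x. indicator {a..1} x * ((x - a) powr (- \<beta>) * right_marchaud \<beta> h x))
     (Beta (1 - \<beta>) \<beta> * h a)"
proof -
  have C: "0 \<le> C" using hoelder[of 1 0] by simp
  obtain hn hn' L where hn: "\<And>n x. (hn n has_real_derivative hn' n x) (at x)"
    "\<And>n. continuous_on UNIV (hn' n)"
    "\<And>n x. \<bar>hn' n x\<bar> \<le> L n"
    "\<And>n. hn n 1 = 0"
    "\<And>n s t. \<bar>hn n t - hn n s\<bar> \<le> C * \<bar>t - s\<bar> powr \<alpha>"
    "\<And>x. (\<lambda>n. hn n x) \<longlonglongrightarrow> h x"
    using hoelder_smooth_approximation[OF hoelder \<alpha> zero] by metis
  have hnm: "hn n \<in> borel_measurable borel" for n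
    using hn(1) by (intro borel_measurable_continuous_onI continuous_at_imp_continuous_on ballI)
      (blast intro: DERIV_isCont)
  note [measurable] = hm hnm
  have lim: "(\<lambda>n. right_marchaud \<beta> (hn n) x) \<longlonglongrightarrow> right_marchaud \<beta> h x" if x: "x \<le> 1" for x
  proof -
    have "(\<lambda>n. LINT u|lborel. indicator {x..1} u * ((hn n x - hn n u) * (u - x) powr (\<beta> - 2)))
      \<longlonglongrightarrow> (LINT u|lborel. indicator {x..1} u * ((h x - h u) * (u - x) powr (\<beta> - 2)))"
    proof (rule integral_dominated_convergence)
      show "integrable lborel (\<lambda>u. C * (indicator {x..1} u * (u - x) powr (\<alpha> + \<beta> - 2)))"
        using has_bochner_integral_powr_left[of x 1 "\<alpha> + \<beta> - 2"] x \<beta>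
        by (intro integrable_mult_right) (auto simp: has_bochner_integral_iff)
      show "AE u in lborel. norm (indicator {x..1} u * ((hn n x - hn n u) * (u - x) powr (\<beta> - 2)))
          \<le> C * (indicator {x..1} u * (u - x) powr (\<alpha> + \<beta> - 2))" for n
        using right_marchaud_integrable(1)[OF hnm hn(5) \<beta>(2) x] by simp
      show "AE u in lborel. (\<lambda>n. indicator {x..1} u * ((hn n x - hn n u) * (u - x) powr (\<beta> - 2)))
          \<longlonglongrightarrow> indicator {x..1} u * ((h x - h u) * (u - x) powr (\<beta> - 2))"
        by (intro AE_I2 tendsto_intros hn(6))
    qed measurable
    then show ?thesis unfolding right_marchaud_def by (intro tendsto_intros hn(6))
  qed
  \<comment> \<open>The bound of \<open>right_marchaud_bound\<close> decreases in x, so its value at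
    \<open>a\<close> serves on all of [a,1].\<close>
  define K where "K = C * (1 + (1 - \<beta>) / (\<alpha> + \<beta> - 1)) * (1 - a) powr (\<alpha> + \<beta> - 1)"
  have bnd: "\<bar>indicator {a..1} x * ((x - a) powr (- \<beta>) * right_marchaud \<beta> g x)\<bar>
      \<le> K * (indicator {a..1} x * (x - a) powr (- \<beta>))"
    if g: "g \<in> borel_measurable borel" "\<And>s t. \<bar>g t - g s\<bar> \<le> C * \<bar>t - s\<bar> powr \<alpha>" "g 1 = 0" for g x
  proof (cases "x \<in> {a..1}")
    case True
    have "\<bar>right_marchaud \<beta> g x\<bar> \<le> C * (1 + (1 - \<beta>) / (\<alpha> + \<beta> - 1)) * (1 - x) powr (\<alpha> + \<beta> - 1)"
      using True by (intro right_marchaud_bound g \<beta>) auto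
    also have "\<dots> \<le> K" unfolding K_def using True C \<beta> by (intro mult_left_mono powr_mono2) auto
    finally show ?thesis using True by (simp add: abs_mult mult.commute mult_right_mono)
  qed auto
  have dom: "integrable lborel (\<lambda>x. K * (indicator {a..1} x * (x - a) powr (- \<beta>)))"
    using has_bochner_integral_powr_left[of a 1 "- \<beta>"] a \<beta>
    by (intro integrable_mult_right) (auto simp: has_bochner_integral_iff)
  have int: "integrable lborel (\<lambda>x. indicator {a..1} x * ((x - a) powr (- \<beta>) * right_marchaud \<beta> h x))"
    by (rule integrable_abs_le[OF dom]) (measurable, rule bnd[OF hm hoelder], simp add: zero)
  have "(\<lambda>n. LINT x|lborel. indicator {a..1} x * ((x - a) powr (- \<beta>) * right_marchaud \<beta> (hn n) x))
     \<longlonglongrightarrow> (LINT x|lborel. indicator {a..1} x * ((x - a) powr (- \<beta>) * right_marchaud \<beta> h x))"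
  proof (rule integral_dominated_convergence[OF _ _ dom])
    show "AE x in lborel. (\<lambda>n. indicator {a..1} x * ((x - a) powr (- \<beta>) * right_marchaud \<beta> (hn n) x))
       \<longlonglongrightarrow> indicator {a..1} x * ((x - a) powr (- \<beta>) * right_marchaud \<beta> h x)"
    proof (rule AE_I2)
      fix x show "(\<lambda>n. indicator {a..1} x * ((x - a) powr (- \<beta>) * right_marchaud \<beta> (hn n) x))
       \<longlonglongrightarrow> indicator {a..1} x * ((x - a) powr (- \<beta>) * right_marchaud \<beta> h x)"
        using lim[of x] by (cases "x \<in> {a..1}") (auto intro!: tendsto_intros)
    qed
    show "AE x in lborel. norm (indicator {a..1} x * ((x - a) powr (- \<beta>) * right_marchaud \<beta> (hn n) x))
        \<le> K * (indicator {a..1} x * (x - a) powr (- \<beta>))" for n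
      using bnd[OF hnm hn(5,4)] by simp
  qed measurable
  moreover have "(LINT x|lborel. indicator {a..1} x * ((x - a) powr (- \<beta>) * right_marchaud \<beta> (hn n) x))
     = Beta (1 - \<beta>) \<beta> * hn n a" for n
    using hn a \<beta> by (intro right_marchaud_inversion_smooth) auto
  moreover have "(\<lambda>n. Beta (1 - \<beta>) \<beta> * hn n a) \<longlonglongrightarrow> Beta (1 - \<beta>) \<beta> * h a"
    by (intro tendsto_intros hn(6))
  ultimately have "(LINT x|lborel. indicator {a..1} x * ((x - a) powr (- \<beta>) * right_marchaud \<beta> h x))
      = Beta (1 - \<beta>) \<beta> * h a" by (auto intro: LIMSEQ_unique)
  with int show ?thesis by (simp add: has_bochner_integral_iff)
qed

section \<open>Generalized Lebesgue--Stieltjes integrals of step functions\<close>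

text \<open>Connects the integrals over \<open>lebesgue_on\<close> in the definitions with those
  over \<open>lborel\<close> computed above.\<close>

lemma has_bochner_integral_lebesgue_on_Icc:
  fixes f :: "real \<Rightarrow> real"
  assumes [measurable]: "f \<in> borel_measurable borel"
  shows "has_bochner_integral (lebesgue_on {a..b}) f I \<longleftrightarrow> has_bochner_integral lborel (\<lambda>x. indicator {a..b} x * f x) I"
proof -
  have "has_bochner_integral (lebesgue_on {a..b}) f I \<longleftrightarrow> has_bochner_integral lebesgue (\<lambda>x. indicator {a..b} x *\<^sub>R f x) I"
    by (rule has_bochner_integral_restrict_space) auto
  also have "\<dots> \<longleftrightarrow> has_bochner_integral lborel (\<lambda>x. indicator {a..b} x * f x) I"
    unfolding has_bochner_integral_iff by (simp add: integrable_completion integral_completion)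
  finally show ?thesis .
qed

lemma integral_lebesgue_on_Icc:
  fixes f :: "real \<Rightarrow> real"
  assumes "f \<in> borel_measurable borel"
  shows "integral\<^sup>L (lebesgue_on {a..b}) f = (LINT x|lborel. indicator {a..b} x * f x)"
  \<comment> \<open>If one side is not integrable, neither is the other, and both integrals are 0 by
    convention.\<close>
  using has_bochner_integral_lebesgue_on_Icc[OF assms, of a b]
  by (metis has_bochner_integral_iff not_integrable_integral_eq)

lemma borel_measurable_lebesgue_on [measurable_dest]:
  "f \<in> borel_measurable borel \<Longrightarrow> f \<in> borel_measurable (lebesgue_on S)"
  by (intro measurable_restrict_space1 measurable_completion) simp

definition left_kernel :: "real \<Rightarrow> (real \<Rightarrow> real) \<Rightarrow> real \<Rightarrow> real \<Rightarrow> real" where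
  "left_kernel \<beta> f x u = (f x - f u) / (x - u) powr (\<beta> + 1)"

text \<open>Unlike finiteness of the norm, which makes the left kernel integrable only at almost every
  \<open>x\<close>, this condition is stated pointwise and is therefore closed under linear combinations
  without any joint measurability argument.\<close>

definition regular_integrand :: "real \<Rightarrow> (real \<Rightarrow> real) \<Rightarrow> bool" where
  "regular_integrand \<beta> f \<longleftrightarrow> f \<in> borel_measurable borel \<and>
     (\<forall>x\<in>{0..1}. integrable (lebesgue_on {0..x}) (left_kernel \<beta> f x)) \<and>
     integrable (lebesgue_on {0..1}) (frac_deriv_left \<beta> 0 f) \<and>
     (\<exists>G. integrable (lebesgue_on {0..1}) G \<and>
        (\<forall>t\<in>{0..1}. \<bar>f t\<bar> / t powr \<beta> + (LINT u|lebesgue_on {0..t}. \<bar>left_kernel \<beta> f t u\<bar>) \<le> G t))"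

lemma left_kernel_axpy:
  "left_kernel \<beta> (\<lambda>t. f t + c * g t) x u = left_kernel \<beta> f x u + c * left_kernel \<beta> g x u"
  by (simp add: left_kernel_def add_divide_distrib[symmetric] algebra_simps diff_divide_distrib)

lemma frac_deriv_left_axpy:
  assumes "regular_integrand \<beta> f" "regular_integrand \<beta> g" "x \<in> {0..1}"
  shows "frac_deriv_left \<beta> 0 (\<lambda>t. f t + c * g t) x = frac_deriv_left \<beta> 0 f x + c * frac_deriv_left \<beta> 0 g x"
proof -
  have "(LINT u|lebesgue_on {0..x}. left_kernel \<beta> (\<lambda>t. f t + c * g t) x u)
      = (LINT u|lebesgue_on {0..x}. left_kernel \<beta> f x u) + c * (LINT u|lebesgue_on {0..x}. left_kernel \<beta> g x u)"
    unfolding left_kernel_axpy using assms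
    by (subst Bochner_Integration.integral_add) (auto simp: regular_integrand_def)
  then show ?thesis
    unfolding left_kernel_def frac_deriv_left_def by (simp add: algebra_simps add_divide_distrib)
qed

text \<open>By the triangle inequality G1 + |c| G2 dominates the combination. This single operation
  suffices to build all step functions inductively.\<close>

lemma regular_integrand_axpy:
  assumes f: "regular_integrand \<beta> f" and g: "regular_integrand \<beta> g"
  shows "regular_integrand \<beta> (\<lambda>t. f t + c * g t)"
proof -
  have [measurable]: "f \<in> borel_measurable borel" "g \<in> borel_measurable borel"
    using f g by (auto simp: regular_integrand_def)
  have K: "integrable (lebesgue_on {0..x}) (left_kernel \<beta> f x)" "integrable (lebesgue_on {0..x}) (left_kernel \<beta> g x)"
    if "x \<in> {0..1}" for x using that f g by (auto simp: regular_integrand_def)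
  obtain G1 where G1: "integrable (lebesgue_on {0..1}) G1"
    "\<And>t. t \<in> {0..1} \<Longrightarrow> \<bar>f t\<bar> / t powr \<beta> + (LINT u|lebesgue_on {0..t}. \<bar>left_kernel \<beta> f t u\<bar>) \<le> G1 t"
    using f by (auto simp: regular_integrand_def)
  obtain G2 where G2: "integrable (lebesgue_on {0..1}) G2"
    "\<And>t. t \<in> {0..1} \<Longrightarrow> \<bar>g t\<bar> / t powr \<beta> + (LINT u|lebesgue_on {0..t}. \<bar>left_kernel \<beta> g t u\<bar>) \<le> G2 t"
    using g by (auto simp: regular_integrand_def)
  have "\<bar>f t + c * g t\<bar> / t powr \<beta> + (LINT u|lebesgue_on {0..t}. \<bar>left_kernel \<beta> (\<lambda>t. f t + c * g t) t u\<bar>)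
     \<le> G1 t + \<bar>c\<bar> * G2 t" if t: "t \<in> {0..1}" for t
  proof -
    have "(LINT u|lebesgue_on {0..t}. \<bar>left_kernel \<beta> (\<lambda>t. f t + c * g t) t u\<bar>)
       \<le> (LINT u|lebesgue_on {0..t}. \<bar>left_kernel \<beta> f t u\<bar> + \<bar>c\<bar> * \<bar>left_kernel \<beta> g t u\<bar>)"
      unfolding left_kernel_axpy
      by (intro integral_mono integrable_abs Bochner_Integration.integrable_add integrable_mult_right K t)
         (auto simp: abs_mult[symmetric])
    also have "\<dots> = (LINT u|lebesgue_on {0..t}. \<bar>left_kernel \<beta> f t u\<bar>) + \<bar>c\<bar> * (LINT u|lebesgue_on {0..t}. \<bar>left_kernel \<beta> g t u\<bar>)"
      by (subst Bochner_Integration.integral_add) (auto intro!: integrable_abs integrable_mult_right K t)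
    finally have 1: "(LINT u|lebesgue_on {0..t}. \<bar>left_kernel \<beta> (\<lambda>t. f t + c * g t) t u\<bar>) \<le> \<dots>" .
    have "\<bar>f t + c * g t\<bar> / t powr \<beta> \<le> (\<bar>f t\<bar> + \<bar>c\<bar> * \<bar>g t\<bar>) / t powr \<beta>"
      by (intro divide_right_mono) (auto simp: abs_mult[symmetric])
    also have "\<dots> = \<bar>f t\<bar> / t powr \<beta> + \<bar>c\<bar> * (\<bar>g t\<bar> / t powr \<beta>)"
      by (simp add: add_divide_distrib)
    finally have 2: "\<bar>f t + c * g t\<bar> / t powr \<beta> \<le> \<dots>" .
    have 3: "\<bar>c\<bar> * (\<bar>g t\<bar> / t powr \<beta> + (LINT u|lebesgue_on {0..t}. \<bar>left_kernel \<beta> g t u\<bar>)) \<le> \<bar>c\<bar> * G2 t"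
      using G2(2)[OF t] by (intro mult_left_mono) auto
    show ?thesis using 1 2 3 G1(2)[OF t] by (simp add: distrib_left)
  qed
  moreover have "integrable (lebesgue_on {0..1}) (\<lambda>t. G1 t + \<bar>c\<bar> * G2 t)"
    by (intro Bochner_Integration.integrable_add integrable_mult_right G1 G2)
  ultimately have G: "\<exists>G. integrable (lebesgue_on {0..1}) G \<and>
        (\<forall>t\<in>{0..1}. \<bar>f t + c * g t\<bar> / t powr \<beta> + (LINT u|lebesgue_on {0..t}. \<bar>left_kernel \<beta> (\<lambda>t. f t + c * g t) t u\<bar>) \<le> G t)"
    by blast
  have "integrable (lebesgue_on {0..1}) (\<lambda>x. frac_deriv_left \<beta> 0 f x + c * frac_deriv_left \<beta> 0 g x)"
    using f g by (intro Bochner_Integration.integrable_add integrable_mult_right) (auto simp: regular_integrand_def)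
  then have D: "integrable (lebesgue_on {0..1}) (frac_deriv_left \<beta> 0 (\<lambda>t. f t + c * g t))"
    by (rule iffD1[OF Bochner_Integration.integrable_cong[OF refl], rotated])
       (simp add: frac_deriv_left_axpy[OF f g])
  have "integrable (lebesgue_on {0..x}) (left_kernel \<beta> (\<lambda>t. f t + c * g t) x)" if "x \<in> {0..1}" for x
    unfolding left_kernel_axpy[abs_def] by (intro Bochner_Integration.integrable_add integrable_mult_right K that)
  with G D show ?thesis unfolding regular_integrand_def by simp
qed

text \<open>Beyond \<tau> the kernel is -(x - u)^(-\<beta> - 1) for u \<le> \<tau> and 0 afterwards.
  Since \<tau> < x, the singularity at u = x is avoided and an elementary antiderivative
  applies.\<close>

lemma left_kernel_indicator:
  assumes \<tau>: "0 \<le> \<tau>" "\<tau> < x" and \<beta>: "0 < \<beta>"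
  shows "has_bochner_integral (lebesgue_on {0..x}) (left_kernel \<beta> (indicator {..\<tau>}) x)
           (- (((x - \<tau>) powr (- \<beta>) - x powr (- \<beta>)) / \<beta>))"
    and "has_bochner_integral (lebesgue_on {0..x}) (\<lambda>u. \<bar>left_kernel \<beta> (indicator {..\<tau>}) x u\<bar>)
           (((x - \<tau>) powr (- \<beta>) - x powr (- \<beta>)) / \<beta>)"
proof -
  let ?I = "((x - \<tau>) powr (- \<beta>) - x powr (- \<beta>)) / \<beta>"
  have "((\<lambda>u. (x - u) powr (- \<beta> - 1)) has_integral ((x - \<tau>) powr (- \<beta>) / \<beta> - (x - 0) powr (- \<beta>) / \<beta>)) {0..\<tau>}"
  proof (rule fundamental_theorem_of_calculus)
    fix u assume u: "u \<in> {0..\<tau>}"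
    have "((\<lambda>u. (x - u) powr (- \<beta>) / \<beta>) has_real_derivative (x - u) powr (- \<beta> - 1)) (at u within {0..\<tau>})"
      using u \<tau> \<beta> by (auto intro!: derivative_eq_intros simp: field_simps)
    then show "((\<lambda>u. (x - u) powr (- \<beta>) / \<beta>) has_vector_derivative (x - u) powr (- \<beta> - 1)) (at u within {0..\<tau>})"
      by (simp add: has_real_derivative_iff_has_vector_derivative)
  qed (use \<tau> in auto)
  then have I: "has_bochner_integral lborel (\<lambda>u. indicator {0..\<tau>} u * (x - u) powr (- \<beta> - 1)) ?I"
    using has_bochner_integral_Icc_nonneg[of "\<lambda>u. (x - u) powr (- \<beta> - 1)" ?I 0 \<tau>] by (simp add: diff_divide_distrib)
  have k: "indicator {0..x} u * left_kernel \<beta> (indicator {..\<tau>}) x u = - (indicator {0..\<tau>} u * (x - u) powr (- \<beta> - 1))" for u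
    using \<tau> powr_minus_divide[of "x - u" "\<beta> + 1"] by (auto simp: left_kernel_def indicator_def)
  have k': "indicator {0..x} u * \<bar>left_kernel \<beta> (indicator {..\<tau>}) x u\<bar> = indicator {0..\<tau>} u * (x - u) powr (- \<beta> - 1)" for u
    using arg_cong[OF k[of u], of abs] by (simp add: abs_mult)
  have [measurable]: "left_kernel \<beta> (indicator {..\<tau>}) x \<in> borel_measurable borel"
    unfolding left_kernel_def[abs_def] by measurable
  show "has_bochner_integral (lebesgue_on {0..x}) (left_kernel \<beta> (indicator {..\<tau>}) x) (- ?I)"
    using has_bochner_integral_minus[OF I] by (subst has_bochner_integral_lebesgue_on_Icc) (simp_all add: k)
  show "has_bochner_integral (lebesgue_on {0..x}) (\<lambda>u. \<bar>left_kernel \<beta> (indicator {..\<tau>}) x u\<bar>) ?I"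
    using I by (subst has_bochner_integral_lebesgue_on_Icc) (simp_all add: k')
qed

lemma left_kernel_indicator_before:
  assumes "x \<le> \<tau>" "u \<le> x"
  shows "left_kernel \<beta> (indicator {..\<tau>}) x u = 0"
  using assms by (simp add: left_kernel_def)

text \<open>Past \<tau> the kernel integral supplies both powers. The result is the derivative of
  the constant 1 started at 0 minus the one started at \<tau>, the form to which the inversion
  applies at each of the two points. At x = \<tau> the second power is
  \<open>0 powr (- \<beta>)\<close>, which is 0.\<close>

lemma frac_deriv_left_indicator:
  assumes \<tau>: "0 \<le> \<tau>" and \<beta>: "0 < \<beta>" and x: "0 \<le> x"
  shows "frac_deriv_left \<beta> 0 (indicator {..\<tau>}) x
    = 1 / Gamma (1 - \<beta>) * (x powr (- \<beta>) - indicator {\<tau>..} x * (x - \<tau>) powr (- \<beta>))"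
proof (cases "x \<le> \<tau>")
  case True
  then have "(LINT u|lebesgue_on {0..x}. left_kernel \<beta> (indicator {..\<tau>}) x u) = (LINT u|lebesgue_on {0..x}. 0)"
    by (intro Bochner_Integration.integral_cong refl left_kernel_indicator_before) auto
  moreover have z: "indicator {\<tau>..} x * (x - \<tau>) powr (- \<beta>) = 0" using True by (auto simp: indicator_def)
  ultimately show ?thesis using True powr_minus_divide[of x \<beta>]
    unfolding frac_deriv_left_def left_kernel_def z by simp
next
  case False
  then show ?thesis
    using left_kernel_indicator(1)[of \<tau> x \<beta>] \<tau> \<beta>
    unfolding frac_deriv_left_def left_kernel_def by (simp add: has_bochner_integral_iff)
qed

lemma integrable_lebesgue_on_indicator_powr:
  fixes \<tau> \<beta> :: real
  assumes "0 \<le> \<tau>" "\<tau> \<le> 1" "\<beta> < 1"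
  shows "integrable (lebesgue_on {0..1}) (\<lambda>x. indicator {\<tau>..} x * (x - \<tau>) powr (- \<beta>))"
proof -
  have eq: "indicator {0..1} x * (indicator {\<tau>..} x * (x - \<tau>) powr (- \<beta>)) = indicator {\<tau>..1} x * (x - \<tau>) powr (- \<beta>)" for x
    using assms by (auto simp: indicator_def)
  show ?thesis
    using has_bochner_integral_powr_left[of \<tau> 1 "- \<beta>"] assms
      has_bochner_integral_lebesgue_on_Icc[of "\<lambda>x. indicator {\<tau>..} x * (x - \<tau>) powr (- \<beta>)" 0 1]
    by (auto simp: eq intro: integrable.intros)
qed

lemma regular_integrand_indicator:
  assumes \<tau>: "0 \<le> \<tau>" "\<tau> \<le> 1" and \<beta>: "0 < \<beta>" "\<beta> < 1"
  shows "regular_integrand \<beta> (indicator {..\<tau>})"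
proof -
  have i0: "integrable (lebesgue_on {0..1}) (\<lambda>x. x powr (- \<beta>))"
    using has_bochner_integral_powr_left[of 0 1 "- \<beta>"] \<beta> has_bochner_integral_lebesgue_on_Icc[of "\<lambda>x. x powr (- \<beta>)" 0 1]
    by (auto intro: integrable.intros)
  note i\<tau> = integrable_lebesgue_on_indicator_powr[OF \<tau> \<beta>(2)]
  have K: "integrable (lebesgue_on {0..x}) (left_kernel \<beta> (indicator {..\<tau>}) x)" for x
  proof (cases "x \<le> \<tau>")
    case True
    have "integrable (lebesgue_on {0..x}) (left_kernel \<beta> (indicator {..\<tau>}) x) \<longleftrightarrow> integrable (lebesgue_on {0..x}) (\<lambda>u. 0 :: real)"
      using True by (intro Bochner_Integration.integrable_cong refl left_kernel_indicator_before) auto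
    then show ?thesis by simp
  next
    case False
    then show ?thesis using left_kernel_indicator(1)[of \<tau> x \<beta>] \<tau> \<beta> by (auto intro: integrable.intros)
  qed
  have "integrable (lebesgue_on {0..1}) (\<lambda>x. 1 / Gamma (1 - \<beta>) * (x powr (- \<beta>) - indicator {\<tau>..} x * (x - \<tau>) powr (- \<beta>)))"
    by (intro integrable_mult_right Bochner_Integration.integrable_diff i0 i\<tau>)
  then have D: "integrable (lebesgue_on {0..1}) (frac_deriv_left \<beta> 0 (indicator {..\<tau>}))"
    by (rule iffD1[OF Bochner_Integration.integrable_cong[OF refl], rotated])
       (simp add: frac_deriv_left_indicator[OF \<tau>(1) \<beta>(1)])
  have bound: "\<bar>indicator {..\<tau>} t\<bar> / t powr \<beta> + (LINT u|lebesgue_on {0..t}. \<bar>left_kernel \<beta> (indicator {..\<tau>}) t u\<bar>)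
      \<le> t powr (- \<beta>) + 1 / \<beta> * (indicator {\<tau>..} t * (t - \<tau>) powr (- \<beta>))" if "t \<in> {0..1}" for t
  proof (cases "t \<le> \<tau>")
    case True
    have "(LINT u|lebesgue_on {0..t}. \<bar>left_kernel \<beta> (indicator {..\<tau>}) t u\<bar>) = (LINT u|lebesgue_on {0..t}. 0)"
      using True by (intro Bochner_Integration.integral_cong refl) (auto simp: left_kernel_indicator_before)
    then show ?thesis using True powr_minus_divide[of t \<beta>] \<beta> by simp
  next
    case False
    then have "(LINT u|lebesgue_on {0..t}. \<bar>left_kernel \<beta> (indicator {..\<tau>}) t u\<bar>) = ((t - \<tau>) powr (- \<beta>) - t powr (- \<beta>)) / \<beta>"
      using left_kernel_indicator(2)[of \<tau> t \<beta>] \<tau> \<beta> by (simp add: has_bochner_integral_iff)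
    also have "\<dots> \<le> (t - \<tau>) powr (- \<beta>) / \<beta>" using \<beta> by (intro divide_right_mono) auto
    finally show ?thesis using False by (simp add: add_increasing)
  qed
  have "integrable (lebesgue_on {0..1}) (\<lambda>t. t powr (- \<beta>) + 1 / \<beta> * (indicator {\<tau>..} t * (t - \<tau>) powr (- \<beta>)))"
    by (intro integrable_mult_right Bochner_Integration.integrable_add i0 i\<tau>)
  then show ?thesis unfolding regular_integrand_def using K D bound by (intro conjI ballI exI) auto
qed

lemma regular_integrand_gls_norm:
  assumes f: "regular_integrand \<beta> f"
  shows "gls_norm \<beta> 0 1 f < \<infinity>"
proof -
  obtain G where G: "integrable (lebesgue_on {0..1}) G"
    "\<And>t. t \<in> {0..1} \<Longrightarrow> \<bar>f t\<bar> / t powr \<beta> + (LINT u|lebesgue_on {0..t}. \<bar>left_kernel \<beta> f t u\<bar>) \<le> G t"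
    using f by (auto simp: regular_integrand_def)
  have K: "integrable (lebesgue_on {0..x}) (left_kernel \<beta> f x)" if "x \<in> {0..1}" for x
    using that f by (auto simp: regular_integrand_def)
  have "gls_norm \<beta> 0 1 f \<le> (\<integral>\<^sup>+ t. ennreal (G t) \<partial>lebesgue_on {0..1})"
    unfolding gls_norm_def
  proof (rule nn_integral_mono)
    fix t assume "t \<in> space (lebesgue_on {0..1::real})"
    then have t: "t \<in> {0..1}" by simp
    have "(\<integral>\<^sup>+ s. ennreal (\<bar>f t - f s\<bar> / (t - s) powr (\<beta> + 1)) \<partial>lebesgue_on {0..t})
      = (\<integral>\<^sup>+ s. ennreal \<bar>left_kernel \<beta> f t s\<bar> \<partial>lebesgue_on {0..t})"
      by (simp add: left_kernel_def)
    also have "\<dots> = ennreal (LINT u|lebesgue_on {0..t}. \<bar>left_kernel \<beta> f t u\<bar>)"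
      using K[OF t] by (intro nn_integral_eq_integral integrable_abs) auto
    finally show "ennreal (\<bar>f t\<bar> / (t - 0) powr \<beta>)
      + (\<integral>\<^sup>+ s. ennreal (\<bar>f t - f s\<bar> / (t - s) powr (\<beta> + 1)) \<partial>lebesgue_on {0..t}) \<le> ennreal (G t)"
      using G(2)[OF t] by (simp add: ennreal_plus[symmetric] ennreal_leI del: ennreal_plus)
  qed
  also have "\<dots> \<le> (\<integral>\<^sup>+ t. ennreal (norm (G t)) \<partial>lebesgue_on {0..1})"
    by (intro nn_integral_mono ennreal_leI) simp
  also have "\<dots> < \<infinity>" using G(1) by (simp add: integrable_iff_bounded)
  finally show ?thesis .
qed

section \<open>Integration of step functions against Hoelder paths on [0,1]\<close>

text \<open>Freezing the path outside [0,1] and subtracting its end value extends it to the whole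
  line with the same Hoelder constant and with value 0 from 1 on, as the inversion requires.\<close>

definition clamped :: "(real \<Rightarrow> real) \<Rightarrow> real \<Rightarrow> real" where
  "clamped g y = g (max 0 (min 1 y)) - g 1"

lemma clamped_hoelder:
  assumes g: "\<forall>s\<in>{0..1}. \<forall>t\<in>{0..1}. \<bar>g t - g s\<bar> \<le> C * \<bar>t - s\<bar> powr \<alpha>"
    and \<alpha>: "0 < \<alpha>"
  shows "\<bar>clamped g t - clamped g s\<bar> \<le> C * \<bar>t - s\<bar> powr \<alpha>"
proof -
  have C: "0 \<le> C" using g[rule_format, of 0 1] by simp
  have "\<bar>clamped g t - clamped g s\<bar> \<le> C * \<bar>max 0 (min 1 t) - max 0 (min 1 s)\<bar> powr \<alpha>"
    unfolding clamped_def using g[rule_format, of "max 0 (min 1 s)" "max 0 (min 1 t)"] by simp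
  also have "\<dots> \<le> C * \<bar>t - s\<bar> powr \<alpha>"
    using C \<alpha> by (intro mult_left_mono powr_mono2) auto
  finally show ?thesis .
qed

lemma frac_deriv_right_eq:
  assumes h: "clamped g \<in> borel_measurable borel" and x: "x \<in> {0..1}"
  shows "frac_deriv_right (1 - \<beta>) 1 (\<lambda>x. g x - g 1) x
    = exp (\<i> * complex_of_real (pi * (1 - \<beta>))) / complex_of_real (Gamma \<beta>) * complex_of_real (right_marchaud \<beta> (clamped g) x)"
proof -
  note [measurable] = h
  have "(LINT u|lebesgue_on {x..1}. ((g x - g 1) - (g u - g 1)) / (u - x) powr ((1 - \<beta>) + 1))
     = (LINT u|lebesgue_on {x..1}. (clamped g x - clamped g u) * (u - x) powr (\<beta> - 2))"
  proof (rule Bochner_Integration.integral_cong[OF refl])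
    fix u assume "u \<in> space (lebesgue_on {x..1})"
    then show "((g x - g 1) - (g u - g 1)) / (u - x) powr ((1 - \<beta>) + 1) = (clamped g x - clamped g u) * (u - x) powr (\<beta> - 2)"
      using x powr_minus_divide[of "u - x" "2 - \<beta>"] by (simp add: clamped_def algebra_simps)
  qed
  also have "\<dots> = (LINT u|lborel. indicator {x..1} u * ((clamped g x - clamped g u) * (u - x) powr (\<beta> - 2)))"
    by (rule integral_lebesgue_on_Icc) measurable
  moreover have "(g x - g 1) / (1 - x) powr (1 - \<beta>) = clamped g x * (1 - x) powr (\<beta> - 1)"
    using x powr_minus_divide[of "1 - x" "1 - \<beta>"] by (simp add: clamped_def)
  ultimately show ?thesis
    unfolding frac_deriv_right_def right_marchaud_def by simp
qed

text \<open>The right derivative of a Hoelder path is bounded on [0,1], since the exponent \<alpha>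
  + \<beta> - 1 in \<open>right_marchaud_bound\<close> is positive. A bounded factor keeps the
  integrable left derivative integrable.\<close>

lemma
  assumes g: "\<forall>s\<in>{0..1}. \<forall>t\<in>{0..1}. \<bar>g t - g s\<bar> \<le> C * \<bar>t - s\<bar> powr \<alpha>"
    and \<alpha>: "0 < \<alpha>" and \<beta>: "0 < \<beta>" "1 - \<alpha> < \<beta>" "\<beta> < 1" and f: "regular_integrand \<beta> f"
  shows regular_integrand_gls_defined: "gls_defined \<beta> 0 1 f g"
    and regular_integrand_gls_integrand: "integrable (lebesgue_on {0..1})
      (\<lambda>x. complex_of_real (frac_deriv_left \<beta> 0 f x) * frac_deriv_right (1 - \<beta>) 1 (\<lambda>x. g x - g 1) x)"
proof -
  note hoel = clamped_hoelder[OF g \<alpha>]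
  have hm[measurable]: "clamped g \<in> borel_measurable borel"
    by (rule hoelder_continuous_measurable(2)[OF hoel \<alpha>])
  have C: "0 \<le> C" using g[rule_format, of 0 1] by simp
  let ?R = "frac_deriv_right (1 - \<beta>) 1 (\<lambda>x. g x - g 1)"
  define c where "c = exp (\<i> * complex_of_real (pi * (1 - \<beta>))) / complex_of_real (Gamma \<beta>)"
  define K where "K = cmod c * (C * (1 + (1 - \<beta>) / (\<alpha> + \<beta> - 1)))"
  have eq: "?R x = c * complex_of_real (right_marchaud \<beta> (clamped g) x)" if "x \<in> {0..1}" for x
    using frac_deriv_right_eq[OF hm that] by (simp add: c_def)
  have bnd: "cmod (?R x) \<le> K" if x: "x \<in> {0..1}" for x
  proof -
    have "\<bar>right_marchaud \<beta> (clamped g) x\<bar> \<le> C * (1 + (1 - \<beta>) / (\<alpha> + \<beta> - 1)) * (1 - x) powr (\<alpha> + \<beta> - 1)"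
      using x \<beta> by (intro right_marchaud_bound hm hoel) (auto simp: clamped_def)
    also have "\<dots> \<le> C * (1 + (1 - \<beta>) / (\<alpha> + \<beta> - 1)) * 1"
      using x \<beta> C by (intro mult_left_mono powr_le1) auto
    finally show ?thesis unfolding eq[OF x] K_def norm_mult by (simp add: mult_left_mono)
  qed
  have "(\<lambda>x. c * complex_of_real (right_marchaud \<beta> (clamped g) x)) \<in> borel_measurable (lebesgue_on {0..1})"
    by measurable
  then have meas: "?R \<in> borel_measurable (lebesgue_on {0..1})"
    by (rule iffD1[OF measurable_cong, rotated]) (simp add: eq)
  have D: "integrable (lebesgue_on {0..1}) (frac_deriv_left \<beta> 0 f)"
    using f by (simp add: regular_integrand_def)
  have "AE x in lebesgue_on {0..1}. cmod (?R x) \<le> K"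
    by (intro AE_I2 bnd) simp
  then show "gls_defined \<beta> 0 1 f g"
    unfolding gls_defined_def using D meas by blast
  show "integrable (lebesgue_on {0..1}) (\<lambda>x. complex_of_real (frac_deriv_left \<beta> 0 f x) * ?R x)"
  proof (rule Bochner_Integration.integrable_bound)
    show "integrable (lebesgue_on {0..1}) (\<lambda>x. K * frac_deriv_left \<beta> 0 f x)"
      by (intro integrable_mult_right D)
    show "(\<lambda>x. complex_of_real (frac_deriv_left \<beta> 0 f x) * ?R x) \<in> borel_measurable (lebesgue_on {0..1})"
      using meas borel_measurable_integrable[OF D] by measurable
    show "AE x in lebesgue_on {0..1}. norm (complex_of_real (frac_deriv_left \<beta> 0 f x) * ?R x)
        \<le> norm (K * frac_deriv_left \<beta> 0 f x)"
    proof (rule AE_I2)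
      fix x :: real assume "x \<in> space (lebesgue_on {0..1})"
      then have "cmod (?R x) \<le> \<bar>K\<bar>" using bnd[of x] by simp
      then show "norm (complex_of_real (frac_deriv_left \<beta> 0 f x) * ?R x) \<le> norm (K * frac_deriv_left \<beta> 0 f x)"
        by (simp add: norm_mult abs_mult mult.commute[of "\<bar>K\<bar>"] mult_left_mono)
    qed
  qed
qed

lemma gls_integral_axpy:
  assumes g: "\<forall>s\<in>{0..1}. \<forall>t\<in>{0..1}. \<bar>g t - g s\<bar> \<le> C * \<bar>t - s\<bar> powr \<alpha>"
    and \<alpha>: "0 < \<alpha>" and \<beta>: "0 < \<beta>" "1 - \<alpha> < \<beta>" "\<beta> < 1"
    and f: "regular_integrand \<beta> f1" "regular_integrand \<beta> f2"
  shows "gls_integral \<beta> 0 1 (\<lambda>t. f1 t + c * f2 t) g = gls_integral \<beta> 0 1 f1 g + of_real c * gls_integral \<beta> 0 1 f2 g"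
proof -
  let ?R = "frac_deriv_right (1 - \<beta>) 1 (\<lambda>x. g x - g 1)"
  note int = regular_integrand_gls_integrand[OF g \<alpha> \<beta>]
  have "(LINT x|lebesgue_on {0..1}. complex_of_real (frac_deriv_left \<beta> 0 (\<lambda>t. f1 t + c * f2 t) x) * ?R x)
     = (LINT x|lebesgue_on {0..1}. complex_of_real (frac_deriv_left \<beta> 0 f1 x) * ?R x
          + of_real c * (complex_of_real (frac_deriv_left \<beta> 0 f2 x) * ?R x))"
    by (rule Bochner_Integration.integral_cong[OF refl]) (simp add: frac_deriv_left_axpy[OF f] algebra_simps)
  also have "\<dots> = (LINT x|lebesgue_on {0..1}. complex_of_real (frac_deriv_left \<beta> 0 f1 x) * ?R x)
      + of_real c * (LINT x|lebesgue_on {0..1}. complex_of_real (frac_deriv_left \<beta> 0 f2 x) * ?R x)"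
    using int[OF f(1)] int[OF f(2)] by (subst Bochner_Integration.integral_add) auto
  finally show ?thesis unfolding gls_integral_def by (simp add: algebra_simps)
qed

text \<open>The inversion at the starting points 0 and \<tau> gives a Beta value times g 0 - g
  \<tau>. The Gamma factors cancel the Beta value, and the two phases multiply to exp(i \<pi>) = -1,
  which reverses the sign.\<close>

lemma gls_integral_indicator:
  assumes g: "\<forall>s\<in>{0..1}. \<forall>t\<in>{0..1}. \<bar>g t - g s\<bar> \<le> C * \<bar>t - s\<bar> powr \<alpha>"
    and \<alpha>: "0 < \<alpha>" and \<beta>: "0 < \<beta>" "1 - \<alpha> < \<beta>" "\<beta> < 1"
    and \<tau>: "0 \<le> \<tau>" "\<tau> \<le> 1"
  shows "gls_integral \<beta> 0 1 (indicator {..\<tau>}) g = of_real (g \<tau> - g 0)"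
proof -
  let ?R = "frac_deriv_right (1 - \<beta>) 1 (\<lambda>x. g x - g 1)"
  define m where "m = right_marchaud \<beta> (clamped g)"
  define B where "B = Beta (1 - \<beta>) \<beta>"
  note hoel = clamped_hoelder[OF g \<alpha>]
  have hm[measurable]: "clamped g \<in> borel_measurable borel"
    by (rule hoelder_continuous_measurable(2)[OF hoel \<alpha>])
  have mm[measurable]: "m \<in> borel_measurable borel" unfolding m_def by measurable
  have part: "has_bochner_integral (lebesgue_on {0..1}) (\<lambda>x. indicator {a..} x * (x - a) powr (- \<beta>) * m x) (B * (g a - g 1))"
    if a: "a \<in> {0..1}" for a
  proof -
    have eq: "indicator {0..1} x * (indicator {a..} x * (x - a) powr (- \<beta>) * m x)
      = indicator {a..1} x * ((x - a) powr (- \<beta>) * m x)" for x using a by (auto simp: indicator_def)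
    have "has_bochner_integral lborel (\<lambda>x. indicator {a..1} x * ((x - a) powr (- \<beta>) * m x)) (B * clamped g a)"
      unfolding m_def B_def using a \<alpha> \<beta>
      by (intro right_marchaud_inversion[OF hm hoel]) (auto simp: clamped_def)
    then show ?thesis
      using a by (subst has_bochner_integral_lebesgue_on_Icc) (simp_all add: eq clamped_def)
  qed
  have "has_bochner_integral (lebesgue_on {0..1})
     (\<lambda>x. indicator {0..} x * (x - 0) powr (- \<beta>) * m x - indicator {\<tau>..} x * (x - \<tau>) powr (- \<beta>) * m x)
     (B * (g 0 - g 1) - B * (g \<tau> - g 1))"
    using \<tau> by (intro has_bochner_integral_diff part) auto
  then have int: "(LINT x|lebesgue_on {0..1}. indicator {0..} x * (x - 0) powr (- \<beta>) * m x - indicator {\<tau>..} x * (x - \<tau>) powr (- \<beta>) * m x)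
     = B * (g 0 - g \<tau>)"
    by (simp add: has_bochner_integral_iff right_diff_distrib)
  define k where "k = exp (\<i> * complex_of_real (pi * (1 - \<beta>))) / complex_of_real (Gamma \<beta>) / complex_of_real (Gamma (1 - \<beta>))"
  have "(LINT x|lebesgue_on {0..1}. complex_of_real (frac_deriv_left \<beta> 0 (indicator {..\<tau>}) x) * ?R x)
     = (LINT x|lebesgue_on {0..1}. k * complex_of_real (indicator {0..} x * (x - 0) powr (- \<beta>) * m x - indicator {\<tau>..} x * (x - \<tau>) powr (- \<beta>) * m x))"
    by (rule Bochner_Integration.integral_cong[OF refl])
       (simp add: frac_deriv_left_indicator[OF \<tau>(1) \<beta>(1)] frac_deriv_right_eq[OF hm] k_def m_def[symmetric] algebra_simps diff_divide_distrib)
  also have "\<dots> = k * complex_of_real (B * (g 0 - g \<tau>))"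
    by (simp only: integral_mult_right_zero integral_complex_of_real int)
  finally have I: "gls_integral \<beta> 0 1 (indicator {..\<tau>}) g
     = exp (\<i> * complex_of_real (pi * \<beta>)) * (k * complex_of_real (B * (g 0 - g \<tau>)))"
    unfolding gls_integral_def by simp
  have e: "exp (\<i> * complex_of_real (pi * \<beta>)) * exp (\<i> * complex_of_real (pi * (1 - \<beta>))) = -1"
    by (simp add: exp_add[symmetric] algebra_simps)
  have G: "Gamma \<beta> \<noteq> 0" "Gamma (1 - \<beta>) \<noteq> 0" using \<beta> less_imp_neq[OF Gamma_real_pos] by (metis, metis diff_gt_0_iff_gt)
  have "exp (\<i> * complex_of_real (pi * \<beta>)) * k = - 1 / (complex_of_real (Gamma \<beta>) * complex_of_real (Gamma (1 - \<beta>)))"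
    unfolding k_def using e by simp
  moreover have "B = Gamma \<beta> * Gamma (1 - \<beta>)" by (simp add: B_def Beta_def mult.commute)
  ultimately have "exp (\<i> * complex_of_real (pi * \<beta>)) * k * complex_of_real B = - 1"
    using G by simp
  then show ?thesis unfolding I by (metis (no_types, opaque_lifting) minus_diff_eq mult.assoc mult_minus1 of_real_minus of_real_mult)
qed

lemma has_gls_integral_step:
  fixes c :: "'i \<Rightarrow> real"
  assumes g: "\<forall>s\<in>{0..1}. \<forall>t\<in>{0..1}. \<bar>g t - g s\<bar> \<le> C * \<bar>t - s\<bar> powr \<alpha>"
    and \<alpha>: "0 < \<alpha>" and K: "finite K" and \<tau>: "\<And>k. k \<in> K \<Longrightarrow> \<sigma> k \<in> {0..1} \<and> \<tau> k \<in> {0..1}"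
  shows "has_gls_integral \<alpha> 0 1 (\<lambda>t. \<Sum>k\<in>K. c k * (indicator {..\<tau> k} t - indicator {..\<sigma> k} t)) g
     (\<Sum>k\<in>K. c k * (g (\<tau> k) - g (\<sigma> k)))"
proof -
  \<comment> \<open>One order serves all summands; the maximum keeps it positive when \<alpha> \<ge>
    1.\<close>
  obtain \<beta> where "max 0 (1 - \<alpha>) < \<beta>" "\<beta> < 1" using dense[of "max 0 (1 - \<alpha>)" 1] \<alpha> by auto
  then have \<beta>: "0 < \<beta>" "1 - \<alpha> < \<beta>" "\<beta> < 1" by auto
  note ax = regular_integrand_axpy and gax = gls_integral_axpy[OF g \<alpha> \<beta>] and ind = gls_integral_indicator[OF g \<alpha> \<beta>]
  have adm: "regular_integrand \<beta> (indicator {..t})" if "t \<in> {0..1}" for t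
    using that \<beta> by (intro regular_integrand_indicator) auto
  have z: "regular_integrand \<beta> (\<lambda>t. 0)" "gls_integral \<beta> 0 1 (\<lambda>t. 0) g = 0"
  proof -
    show "regular_integrand \<beta> (\<lambda>t. 0)"
      using ax[OF adm[of 0] adm[of 0], of "-1"] by simp
    show "gls_integral \<beta> 0 1 (\<lambda>t. 0) g = 0"
      using gax[OF adm[of 0] adm[of 0], of "-1"] by simp
  qed
  have "regular_integrand \<beta> (\<lambda>t. \<Sum>k\<in>K. c k * (indicator {..\<tau> k} t - indicator {..\<sigma> k} t)) \<and>
    gls_integral \<beta> 0 1 (\<lambda>t. \<Sum>k\<in>K. c k * (indicator {..\<tau> k} t - indicator {..\<sigma> k} t)) g
      = of_real (\<Sum>k\<in>K. c k * (g (\<tau> k) - g (\<sigma> k)))"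
    using K \<tau>
  proof (induction K)
    case empty
    then show ?case using z by simp
  next
    case (insert k K)
    let ?f = "\<lambda>t. \<Sum>k\<in>K. c k * (indicator {..\<tau> k} t - indicator {..\<sigma> k} t)"
    let ?d = "\<lambda>t. indicator {..\<tau> k} t + (- 1) * indicator {..\<sigma> k} t"
    have f: "regular_integrand \<beta> ?f" "gls_integral \<beta> 0 1 ?f g = of_real (\<Sum>k\<in>K. c k * (g (\<tau> k) - g (\<sigma> k)))"
      using insert by auto
    have k: "\<sigma> k \<in> {0..1}" "\<tau> k \<in> {0..1}" using insert by auto
    have d: "regular_integrand \<beta> ?d" by (intro ax adm k)
    have dI: "gls_integral \<beta> 0 1 ?d g = of_real (g (\<tau> k) - g (\<sigma> k))"
      using gax[OF adm[OF k(2)] adm[OF k(1)], of "-1"] ind[of "\<tau> k"] ind[of "\<sigma> k"] k by simp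
    have eq: "(\<lambda>t. \<Sum>k\<in>insert k K. c k * (indicator {..\<tau> k} t - indicator {..\<sigma> k} t)) = (\<lambda>t. ?f t + c k * ?d t)"
      using insert by (simp add: algebra_simps)
    show ?case unfolding eq using ax[OF f(1) d, of "c k"] gax[OF f(1) d, of "c k"] f(2) dI insert by simp
  qed
  then have f: "regular_integrand \<beta> (\<lambda>t. \<Sum>k\<in>K. c k * (indicator {..\<tau> k} t - indicator {..\<sigma> k} t))"
    and I: "complex_of_real (\<Sum>k\<in>K. c k * (g (\<tau> k) - g (\<sigma> k)))
      = gls_integral \<beta> 0 1 (\<lambda>t. \<Sum>k\<in>K. c k * (indicator {..\<tau> k} t - indicator {..\<sigma> k} t)) g"
    by simp_all
  have "(\<lambda>t. \<Sum>k\<in>K. c k * (indicator {..\<tau> k} t - indicator {..\<sigma> k} t)) \<in> borel_measurable (lebesgue_on {0..1})"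
    using f by (intro borel_measurable_lebesgue_on) (simp add: regular_integrand_def)
  then show ?thesis
    unfolding has_gls_integral_def
    using \<beta> I regular_integrand_gls_norm[OF f] regular_integrand_gls_defined[OF g \<alpha> \<beta> f] by blast
qed

section \<open>Attaining a random variable by stopping a simple strategy\<close>

text \<open>\<tau> is the infimum of the times with \<open>f\<close> strictly above
  \<open>y\<close>; continuity forces \<open>f \<tau> = y\<close>. Strict excess is an open
  condition, so it also occurs at rational times arbitrarily soon after \<tau>, which will make
  stopping at \<tau> adapted.\<close>

lemma first_exit:
  fixes f :: "real \<Rightarrow> real"
  assumes ab: "a \<le> b" and cont: "continuous_on {a..b} f" and fa: "f a \<le> y" and fb: "y < f b"
  obtains \<tau> where "a \<le> \<tau>" "\<tau> < b" "f \<tau> = y" "\<And>u. a \<le> u \<Longrightarrow> u \<le> \<tau> \<Longrightarrow> f u \<le> y"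
    "\<And>t. \<tau> < t \<Longrightarrow> \<exists>q\<in>\<rat>. \<tau> < q \<and> q < t \<and> q \<le> b \<and> y < f q"
proof -
  define S where "S = {x\<in>{a..b}. y < f x}"
  define \<tau> where "\<tau> = Inf S"
  have bS: "b \<in> S" using ab fb by (simp add: S_def)
  have bdd: "bdd_below S" by (auto simp: S_def intro!: bdd_belowI[of _ a])
  have a\<tau>: "a \<le> \<tau>" unfolding \<tau>_def using bS by (intro cInf_greatest) (auto simp: S_def)
  have \<tau>b: "\<tau> \<le> b" unfolding \<tau>_def using bS bdd by (rule cInf_lower)
  have below: "f u \<le> y" if "a \<le> u" "u < \<tau>" for u
  proof (rule ccontr)
    assume "\<not> f u \<le> y"
    then have "u \<in> S" using that \<tau>b by (simp add: S_def)
    then have "\<tau> \<le> u" unfolding \<tau>_def using bdd by (intro cInf_lower)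
    then show False using that by simp
  qed
  have ed: "\<exists>d>0. \<forall>x'\<in>{a..b}. \<bar>x' - x\<bar> < d \<longrightarrow> \<bar>f x' - f x\<bar> < e" if "x \<in> {a..b}" "0 < e" for x e
    using cont[unfolded continuous_on_iff dist_real_def, rule_format, OF that] by auto
  have le: "f \<tau> \<le> y"
  proof (rule ccontr)
    assume *: "\<not> f \<tau> \<le> y"
    then have "a < \<tau>" using a\<tau> fa by (cases "a = \<tau>") auto
    obtain d where d: "d > 0" "\<forall>x'\<in>{a..b}. \<bar>x' - \<tau>\<bar> < d \<longrightarrow> \<bar>f x' - f \<tau>\<bar> < f \<tau> - y"
      using ed[of \<tau> "f \<tau> - y"] * a\<tau> \<tau>b by auto
    define x where "x = max a (\<tau> - d / 2)"
    have "x \<in> {a..b}" "\<bar>x - \<tau>\<bar> < d" "a \<le> x" "x < \<tau>"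
      using d(1) \<open>a < \<tau>\<close> \<tau>b by (auto simp: x_def)
    then show False using d(2) below[of x] by force
  qed
  have ge: "y \<le> f \<tau>"
  proof (rule ccontr)
    assume *: "\<not> y \<le> f \<tau>"
    obtain d where d: "d > 0" "\<forall>x'\<in>{a..b}. \<bar>x' - \<tau>\<bar> < d \<longrightarrow> \<bar>f x' - f \<tau>\<bar> < y - f \<tau>"
      using ed[of \<tau> "y - f \<tau>"] * a\<tau> \<tau>b by auto
    have "\<tau> + d \<le> x" if x: "x \<in> S" for x
    proof (rule ccontr)
      assume "\<not> \<tau> + d \<le> x"
      moreover have "\<tau> \<le> x" unfolding \<tau>_def using x bdd by (rule cInf_lower)
      ultimately have "\<bar>f x - f \<tau>\<bar> < y - f \<tau>" using d x by (auto simp: S_def)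
      then show False using x by (auto simp: S_def)
    qed
    then have "\<tau> + d \<le> \<tau>" unfolding \<tau>_def using bS by (intro cInf_greatest) auto
    then show False using d by simp
  qed
  have eq: "f \<tau> = y" using le ge by simp
  have \<tau>b': "\<tau> < b" using \<tau>b eq fb by (cases "\<tau> = b") auto
  have after: "\<exists>q\<in>\<rat>. \<tau> < q \<and> q < t \<and> q \<le> b \<and> y < f q" if t: "\<tau> < t" for t
  proof -
    obtain x where x: "x \<in> S" "x < t"
      using cInf_lessD[of S t] t bS unfolding \<tau>_def by blast
    have "\<tau> \<le> x" unfolding \<tau>_def using x(1) bdd by (rule cInf_lower)
    then have "\<tau> < x" using x eq by (cases "\<tau> = x") (auto simp: S_def)
    obtain d where d: "d > 0" "\<forall>x'\<in>{a..b}. \<bar>x' - x\<bar> < d \<longrightarrow> \<bar>f x' - f x\<bar> < f x - y"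
      using ed[of x "f x - y"] x by (auto simp: S_def)
    obtain q where q: "q \<in> \<rat>" "max \<tau> (x - d) < q" "q < x"
      using Rats_dense_in_real[of "max \<tau> (x - d)" x] \<open>\<tau> < x\<close> d by auto
    have "\<bar>f q - f x\<bar> < f x - y" using d(2) q a\<tau> x by (auto simp: S_def)
    then show ?thesis using q x a\<tau> by (intro bexI[of _ q]) (auto simp: S_def)
  qed
  have "f u \<le> y" if "a \<le> u" "u \<le> \<tau>" for u using that below[of u] eq by (cases "u = \<tau>") auto
  then show thesis using that[OF a\<tau> \<tau>b' eq] after by blast
qed

section \<open>Piecewise constant strategies on a grid accumulating at time 1\<close>

lemma stochastic_basis_measurable_mono:
  assumes "stochastic_basis M \<F>" "r \<in> {0..1}" "t \<in> {0..1}" "r \<le> t" "f \<in> measurable (\<F> r) N"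
  shows "f \<in> measurable (\<F> t) N"
proof -
  have "subalgebra (\<F> t) (\<F> r)"
    using assms(1-4) unfolding stochastic_basis_def subalgebra_def by blast
  then show ?thesis using assms(5) by (rule measurable_from_subalg)
qed

lemma pred_Ball_countable:
  assumes "countable I" "\<And>i. i \<in> I \<Longrightarrow> Measurable.pred M (\<lambda>x. P x i)"
  shows "Measurable.pred M (\<lambda>x. \<forall>i\<in>I. P x i)"
  using assms unfolding pred_def by (intro sets.sets_Collect_countable_All') auto

text \<open>A strategy will hold the constant position \<open>w k\<close> on each interval \<open>(l k, r k]\<close>.\<close>

locale interval_grid =
  fixes s :: "nat \<Rightarrow> real" and K :: "nat \<Rightarrow> 'i set" and l r :: "'i \<Rightarrow> real"
  assumes finite_K: "finite (K m)"
    and K_mono: "m \<le> n \<Longrightarrow> K m \<subseteq> K n"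
    and K_range: "k \<in> K m \<Longrightarrow> s 0 \<le> l k \<and> l k \<le> r k \<and> r k \<le> s m"
    and K_new: "k \<in> K n \<Longrightarrow> k \<notin> K m \<Longrightarrow> s m \<le> l k"
    and s_nonneg: "0 \<le> s 0" and s_less: "s m < 1" and s_cofinal: "t < 1 \<Longrightarrow> \<exists>m. t \<le> s m"
begin

definition position :: "nat \<Rightarrow> ('i \<Rightarrow> real) \<Rightarrow> real \<Rightarrow> real" where
  "position m w t = (\<Sum>k\<in>K m. w k * (indicator {..r k} t - indicator {..l k} t))"

text \<open>By \<open>has_gls_integral_step\<close> this is the integral against \<open>g\<close> of
  the position cut off at time \<open>u\<close>.\<close>

definition gain :: "nat \<Rightarrow> ('i \<Rightarrow> real) \<Rightarrow> (real \<Rightarrow> real) \<Rightarrow> real \<Rightarrow> real" where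
  "gain m w g u = (\<Sum>k\<in>K m. w k * (g (min u (r k)) - g (min u (l k))))"

lemma K_bounds: "k \<in> K m \<Longrightarrow> 0 \<le> l k \<and> l k \<le> r k \<and> r k < 1"
  using K_range[of k m] s_nonneg s_less[of m] by auto

text \<open>Intervals added after stage m start at or after s m, hence contribute nothing up to that
  time. So position and gain at a given time do not depend on the stage, once it covers that
  time.\<close>

lemma sum_K_eq:
  fixes f :: "'i \<Rightarrow> real"
  assumes z: "\<And>k n. k \<in> K n \<Longrightarrow> t \<le> l k \<Longrightarrow> f k = 0" and t: "t \<le> s m" "t \<le> s m'"
  shows "sum f (K m) = sum f (K m')"
proof -
  have *: "sum f (K i) = sum f (K j)" if "i \<le> j" "t \<le> s i" for i j
  proof (rule sum.mono_neutral_left[OF finite_K K_mono[OF that(1)]], rule ballI)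
    fix k assume k: "k \<in> K j - K i"
    then have "s i \<le> l k" using K_new[of k j i] by simp
    then show "f k = 0" using z[of k j] k that(2) by simp
  qed
  show ?thesis
  proof (cases "m \<le> m'")
    case True
    then show ?thesis using * t(1) by blast
  next
    case False
    then show ?thesis using *[of m' m] t(2) by simp
  qed
qed

lemma position_eq: "t \<le> s m \<Longrightarrow> t \<le> s m' \<Longrightarrow> position m w t = position m' w t"
  unfolding position_def by (rule sum_K_eq) (use K_bounds in \<open>force simp: indicator_def\<close>)+

lemma gain_eq: "u \<le> s m \<Longrightarrow> u \<le> s m' \<Longrightarrow> gain m w g u = gain m' w g u"
  unfolding gain_def
proof (rule sum_K_eq)
  fix k n assume "k \<in> K n" "u \<le> l k"
  then show "w k * (g (min u (r k)) - g (min u (l k))) = 0" using K_bounds[of k n] by simp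
qed

lemma gain_start: "gain m w g (s 0) = 0"
proof -
  have "min (s 0) (r k) = s 0 \<and> min (s 0) (l k) = s 0" if "k \<in> K m" for k using K_range[OF that] by auto
  then show ?thesis unfolding gain_def by (intro sum.neutral) auto
qed

lemma continuous_on_gain:
  assumes "continuous_on {0..1} g"
  shows "continuous_on {0..1} (gain m w g)"
  unfolding gain_def[abs_def] using K_bounds
  by (intro continuous_intros continuous_on_compose2[OF assms]) force+

end

lemma continuous_on_hoelder:
  fixes g :: "real \<Rightarrow> real"
  assumes g: "\<forall>s\<in>{0..1}. \<forall>t\<in>{0..1}. \<bar>g t - g s\<bar> \<le> C * \<bar>t - s\<bar> powr \<alpha>" and \<alpha>: "0 < \<alpha>"
  shows "continuous_on {0..1} g"
proof -
  have "continuous_on {0..1} (\<lambda>x. clamped g x + g 1)"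
    using hoelder_continuous_measurable(1)[OF clamped_hoelder[OF g \<alpha>] \<alpha>]
    by (intro continuous_intros) (auto intro: continuous_on_subset)
  then show ?thesis by (rule continuous_on_cong[THEN iffD1, rotated -1]) (auto simp: clamped_def)
qed

context interval_grid
begin

text \<open>The gain is continuous in time, starts at 0 and almost surely exceeds |\<xi>| in some
  stage, so it takes the value |\<xi>| at an exit time \<tau> before 1. Level and sign are known at
  \<open>s 0\<close>, before any position is taken.\<close>

theorem attain_random_variable:
  fixes \<F> :: "real \<Rightarrow> 'a measure" and X :: "real \<Rightarrow> 'a \<Rightarrow> real" and w :: "'i \<Rightarrow> 'a \<Rightarrow> real" and \<xi> :: "'a \<Rightarrow> real"
  assumes basis: "stochastic_basis M \<F>" and adapted: "adapted_process \<F> X"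
    and hoelder: "AE \<omega> in M. \<forall>s\<in>{0..1}. \<forall>t\<in>{0..1}. \<bar>X t \<omega> - X s \<omega>\<bar> \<le> C * \<bar>t - s\<bar> powr \<alpha>"
    and \<alpha>: "0 < \<alpha>"
    and w: "\<And>k m. k \<in> K m \<Longrightarrow> w k \<in> borel_measurable (\<F> (l k))"
    and \<xi>: "\<xi> \<in> borel_measurable (\<F> (s 0))"
    and reach: "AE \<omega> in M. \<exists>m. \<exists>u\<in>{s 0..s m}. \<bar>\<xi> \<omega>\<bar> < gain m (\<lambda>k. w k \<omega>) (\<lambda>t. X t \<omega>) u"
  shows "\<exists>\<phi>. adapted_process \<F> \<phi> \<and>
     (AE \<omega> in M. has_gls_integral \<alpha> 0 1 (\<lambda>t. \<phi> t \<omega>) (\<lambda>t. X t \<omega>) (\<xi> \<omega>))"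
proof -
  define Y where "Y m u \<omega> = gain m (\<lambda>k. w k \<omega>) (\<lambda>t. X t \<omega>) u" for m u \<omega>
  \<comment> \<open>A strict excess over the level is visible at rational times before \<open>t\<close>, so that \<open>alive t\<close> is
    an event of \<open>\<F> t\<close> even though the filtration need not be complete or right-continuous.\<close>
  define alive where "alive t \<omega> \<longleftrightarrow> (\<forall>m. \<forall>q\<in>\<rat>. s 0 \<le> q \<and> q < t \<and> q \<le> s m \<longrightarrow> Y m q \<omega> \<le> \<bar>\<xi> \<omega>\<bar>)" for t \<omega>
  \<comment> \<open>Some stage covering \<open>t\<close>; by \<open>position_eq\<close> the choice
    is immaterial. For \<open>t \<ge> 1\<close> there is none, and \<phi> is set to 0.\<close>
  define lev where "lev t = (SOME m. t \<le> s m)" for t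
  define \<phi> where "\<phi> t \<omega> = (if s 0 < t \<and> t < 1 \<and> alive t \<omega>
      then sgn (\<xi> \<omega>) * position (lev t) (\<lambda>k. w k \<omega>) t else 0)" for t \<omega>
  have s0: "s 0 \<in> {0..1}" using s_nonneg s_less[of 0] by auto
  have lev: "t \<le> s (lev t)" if "t < 1" for t
    unfolding lev_def using s_cofinal[OF that] by (rule someI_ex)
  note up = stochastic_basis_measurable_mono[OF basis]
  have Xup: "X p \<in> borel_measurable (\<F> t)" if "0 \<le> p" "p \<le> t" "t \<le> 1" for p t
    using that adapted by (intro up[of p t]) (auto simp: adapted_process_def)
  have wup: "w k \<in> borel_measurable (\<F> t)" if "k \<in> K m" "l k \<le> t" "t \<le> 1" for k m t
    using that w[OF that(1)] K_bounds[OF that(1)] by (intro up[of "l k" t]) auto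
  have Ymeas: "Y m q \<in> borel_measurable (\<F> t)" if q: "0 \<le> q" "q \<le> t" "t \<le> 1" for m q t
    unfolding Y_def gain_def
  proof (rule borel_measurable_sum)
    fix k assume k: "k \<in> K m"
    show "(\<lambda>\<omega>. w k \<omega> * (X (min q (r k)) \<omega> - X (min q (l k)) \<omega>)) \<in> borel_measurable (\<F> t)"
    \<comment> \<open>The weight of an interval starting after \<open>q\<close> may be unknown at
      time \<open>t\<close>, but then its increment vanishes.\<close>
    proof (cases "q \<le> l k")
      case True
      then show ?thesis using K_bounds[OF k] by simp
    next
      case False
      then show ?thesis using K_bounds[OF k] q
        by (intro borel_measurable_times borel_measurable_diff wup[OF k] Xup) auto
    qed
  qed
  have "\<phi> t \<in> borel_measurable (\<F> t)" if t: "t \<in> {0..1}" for t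
  proof (cases "s 0 < t \<and> t < 1")
    case False
    then show ?thesis unfolding \<phi>_def by auto
  next
    case True
    have [measurable]: "\<xi> \<in> borel_measurable (\<F> t)" using up[OF s0 t _ \<xi>] True by simp
    have [measurable]: "Measurable.pred (\<F> t) (alive t)"
      unfolding alive_def
    proof (intro pred_intros_countable pred_Ball_countable[OF countable_rat] pred_intros_imp')
      fix m q assume "s 0 \<le> q \<and> q < t \<and> q \<le> s m"
      then have [measurable]: "Y m q \<in> borel_measurable (\<F> t)" using s0 t by (intro Ymeas) auto
      show "Measurable.pred (\<F> t) (\<lambda>\<omega>. Y m q \<omega> \<le> \<bar>\<xi> \<omega>\<bar>)" by measurable
    qed
    have [measurable]: "(\<lambda>\<omega>. position m (\<lambda>k. w k \<omega>) t) \<in> borel_measurable (\<F> t)" for m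
      unfolding position_def
    proof (rule borel_measurable_sum)
      fix k assume k: "k \<in> K m"
      show "(\<lambda>\<omega>. w k \<omega> * (indicator {..r k} t - indicator {..l k} t)) \<in> borel_measurable (\<F> t)"
      proof (cases "t \<le> l k")
        case True
        then show ?thesis using K_bounds[OF k] by simp
      next
        case False
        then show ?thesis using t by (intro borel_measurable_times wup[OF k]) auto
      qed
    qed
    show ?thesis unfolding \<phi>_def using True by measurable
  qed
  then have "adapted_process \<F> \<phi>" unfolding adapted_process_def by blast
  moreover have "AE \<omega> in M. has_gls_integral \<alpha> 0 1 (\<lambda>t. \<phi> t \<omega>) (\<lambda>t. X t \<omega>) (\<xi> \<omega>)"
    using hoelder reach
  proof eventually_elim
    case (elim \<omega>)
    let ?g = "\<lambda>t. X t \<omega>" and ?w = "\<lambda>k. w k \<omega>"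
    obtain m b where b: "b \<in> {s 0..s m}" "\<bar>\<xi> \<omega>\<bar> < gain m ?w ?g b" using elim(2) by blast
    have "continuous_on {s 0..b} (gain m ?w ?g)"
      using b s0 s_less[of m]
      by (intro continuous_on_subset[OF continuous_on_gain[OF continuous_on_hoelder[OF elim(1) \<alpha>]]]) auto
    then obtain \<tau> where \<tau>: "s 0 \<le> \<tau>" "\<tau> < b" "gain m ?w ?g \<tau> = \<bar>\<xi> \<omega>\<bar>"
      and before: "\<And>u. s 0 \<le> u \<Longrightarrow> u \<le> \<tau> \<Longrightarrow> gain m ?w ?g u \<le> \<bar>\<xi> \<omega>\<bar>"
      and after: "\<And>t. \<tau> < t \<Longrightarrow> \<exists>q\<in>\<rat>. \<tau> < q \<and> q < t \<and> q \<le> b \<and> \<bar>\<xi> \<omega>\<bar> < gain m ?w ?g q"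
      using first_exit[of "s 0" b "gain m ?w ?g" "\<bar>\<xi> \<omega>\<bar>"] b gain_start[of m ?w ?g] by auto
    have \<tau>m: "\<tau> \<le> s m" "\<tau> < 1" using \<tau> b s_less[of m] by auto
    \<comment> \<open>A time after \<tau> is excluded by a rational time of excess shortly after
      \<tau>. Up to \<tau> the bound known for stage \<open>m\<close> extends to every stage by
      \<open>gain_eq\<close>.\<close>
    have alive: "alive t \<omega> \<longleftrightarrow> t \<le> \<tau>" for t
    proof
      assume "alive t \<omega>"
      show "t \<le> \<tau>"
      proof (rule ccontr)
        assume "\<not> t \<le> \<tau>"
        then obtain q where "q \<in> \<rat>" "\<tau> < q" "q < t" "q \<le> b" "\<bar>\<xi> \<omega>\<bar> < gain m ?w ?g q" using after[of t] by auto
        moreover have "Y m q \<omega> \<le> \<bar>\<xi> \<omega>\<bar>"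
          using \<open>alive t \<omega>\<close> calculation \<tau> b unfolding alive_def by auto
        ultimately show False unfolding Y_def by simp
      qed
    next
      assume t: "t \<le> \<tau>"
      show "alive t \<omega>" unfolding alive_def Y_def
      proof (intro allI ballI impI)
        fix n q assume q: "s 0 \<le> q \<and> q < t \<and> q \<le> s n"
        then have "gain n ?w ?g q = gain m ?w ?g q" using t \<tau>m by (intro gain_eq) auto
        then show "gain n ?w ?g q \<le> \<bar>\<xi> \<omega>\<bar>" using before[of q] q t by simp
      qed
    qed
    \<comment> \<open>Stopping cuts all end points at \<tau>, so along the path only the finitely
      many intervals of stage \<open>m\<close> matter and \<phi> is a step function.\<close>
    have \<phi>: "\<phi> t \<omega> = (\<Sum>k\<in>K m. (sgn (\<xi> \<omega>) * w k \<omega>) * (indicator {..min \<tau> (r k)} t - indicator {..min \<tau> (l k)} t))" for t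
    proof -
      consider "t \<le> s 0" | "\<tau> < t" | "s 0 < t" "t \<le> \<tau>" by linarith
      then show ?thesis
      proof cases
        case 1
        have "indicator {..min \<tau> (r k)} t = (1 :: real) \<and> indicator {..min \<tau> (l k)} t = (1 :: real)" if "k \<in> K m" for k
          using 1 \<tau> K_range[OF that] by (auto simp: indicator_def)
        then show ?thesis using 1 by (simp add: \<phi>_def)
      next
        case 2
        then show ?thesis by (simp add: \<phi>_def alive)
      next
        case 3
        have "\<phi> t \<omega> = sgn (\<xi> \<omega>) * position m ?w t"
          using 3 \<tau>m lev[of t] position_eq[of t "lev t" m ?w] by (simp add: \<phi>_def alive)
        also have "\<dots> = (\<Sum>k\<in>K m. (sgn (\<xi> \<omega>) * w k \<omega>) * (indicator {..min \<tau> (r k)} t - indicator {..min \<tau> (l k)} t))"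
          unfolding position_def sum_distrib_left using 3
          by (intro sum.cong refl) (auto simp: indicator_def)
        finally show ?thesis .
      qed
    qed
    have "has_gls_integral \<alpha> 0 1 (\<lambda>t. \<phi> t \<omega>) ?g
       (\<Sum>k\<in>K m. (sgn (\<xi> \<omega>) * w k \<omega>) * (?g (min \<tau> (r k)) - ?g (min \<tau> (l k))))"
      unfolding \<phi>
    proof (rule has_gls_integral_step[OF elim(1) \<alpha> finite_K])
      fix k assume "k \<in> K m"
      from K_bounds[OF this] show "min \<tau> (l k) \<in> {0..1} \<and> min \<tau> (r k) \<in> {0..1}"
        using \<tau> \<tau>m s0 by auto
    qed
    also have "(\<Sum>k\<in>K m. (sgn (\<xi> \<omega>) * w k \<omega>) * (?g (min \<tau> (r k)) - ?g (min \<tau> (l k)))) = sgn (\<xi> \<omega>) * gain m ?w ?g \<tau>"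
      unfolding gain_def sum_distrib_left by (simp add: mult.assoc)
    also have "\<dots> = \<xi> \<omega>" using \<tau>(3) by (simp add: sgn_mult_abs)
    finally show ?case .
  qed
  ultimately show ?thesis by blast
qed

end

section \<open>Existence of integrals with a given distribution\<close>

text \<open>Continuity of the distribution function \<open>H\<close> of \<open>X\<close> makes
  \<open>H\<close> applied to \<open>X\<close> uniform on [0,1]; the generalised inverse of
  \<open>F\<close> turns this into \<open>F\<close>.\<close>

lemma quantile_transform:
  fixes F :: "real \<Rightarrow> real"
  assumes M: "prob_space M" and X[measurable]: "X \<in> borel_measurable M"
    and cont: "continuous_on UNIV (cdf (distr M borel X))" and F: "distribution_function F"
  obtains q :: "real \<Rightarrow> real" where "q \<in> borel_measurable borel" "cdf (distr M borel (\<lambda>\<omega>. q (X \<omega>))) = F"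
proof -
  define D where "D = distr M borel X"
  interpret D: real_distribution D
    unfolding D_def using M X by (intro prob_space.real_distribution_distr)
  interpret F: right_continuous_mono F 0 1
    using F by unfold_locales (auto simp: distribution_function_def)
  define H where "H = cdf D"
  have Hmono: "mono H" unfolding H_def by (intro monoI D.cdf_nondecreasing)
  then have [measurable]: "H \<in> borel_measurable borel" by (rule borel_measurable_mono)
  have Hcont: "continuous_on S H" for S using cont unfolding H_def D_def by (rule continuous_on_subset) simp
  have hit: "\<exists>z. H z = p" if p: "0 < p" "p < 1" for p
  proof -
    obtain a where a: "H a < p"
      using eventually_happens'[OF trivial_limit_at_bot_linorder order_tendstoD(2)[OF D.cdf_lim_at_bot p(1)]]
      unfolding H_def by blast
    obtain b where b: "p < H b"
      using eventually_happens'[OF trivial_limit_at_top_linorder order_tendstoD(1)[OF D.cdf_lim_at_top_prob p(2)]]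
      unfolding H_def by blast
    have "a \<le> b" using a b monoD[OF Hmono, of b a] by (cases "a \<le> b") auto
    then show ?thesis using IVT'[of H a p b] a b Hcont by auto
  qed
  have unif: "measure D {x. H x \<le> p} = p" if p: "0 < p" "p < 1" for p
  proof (rule antisym)
    obtain z where z: "H z = p" using hit p by blast
    have "measure D {..z} \<le> measure D {x. H x \<le> p}"
      using z monoD[OF Hmono] by (intro D.finite_measure_mono) auto
    then show "p \<le> measure D {x. H x \<le> p}" using z by (simp add: H_def cdf_def)
    \<comment> \<open>\<open>H\<close> may be flat at level \<open>p\<close>, so the set can extend
      beyond \<open>z\<close>; it is bounded through levels \<open>p''\<close> slightly above
      \<open>p\<close>.\<close>
    show "measure D {x. H x \<le> p} \<le> p"
    proof (rule dense_ge)
      fix p' assume p': "p < p'"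
      define p'' where "p'' = min p' ((p + 1) / 2)"
      have p'': "p < p''" "0 < p''" "p'' < 1" "p'' \<le> p'" using p p' by (auto simp: p''_def min_def)
      obtain z where z: "H z = p''" using hit p'' by blast
      have "x \<le> z" if "H x \<le> p" for x
        using monoD[OF Hmono, of z x] that z p'' by (cases "x \<le> z") auto
      then have "measure D {x. H x \<le> p} \<le> measure D {..z}"
        by (intro D.finite_measure_mono) auto
      then show "measure D {x. H x \<le> p} \<le> p'" using z p'' by (simp add: H_def cdf_def)
    qed
  qed
  have zero: "measure D {x. H x \<le> 0} = 0"
  proof (rule antisym[OF _ measure_nonneg], rule dense_ge)
    fix p :: real assume "0 < p"
    then have p: "0 < min p (1 / 2)" "min p (1 / 2) < 1" by auto
    have "measure D {x. H x \<le> 0} \<le> measure D {x. H x \<le> min p (1 / 2)}"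
      using p by (intro D.finite_measure_mono) auto
    then show "measure D {x. H x \<le> 0} \<le> p" using unif[OF p] by simp
  qed
  have one: "measure D {x. H x < 1} = 1"
  proof (rule antisym[OF D.prob_le_1], rule dense_le)
    fix p :: real assume "p < 1"
    then have p: "0 < max p (1 / 2)" "max p (1 / 2) < 1" by auto
    have "measure D {x. H x \<le> max p (1 / 2)} \<le> measure D {x. H x < 1}"
      using p by (intro D.finite_measure_mono) auto
    then show "p \<le> measure D {x. H x < 1}" using unif[OF p] by simp
  qed
  have ae: "AE x in D. 0 < H x \<and> H x < 1"
  proof -
    have "AE x in D. x \<in> {x. H x < 1}"
      using one by (rule D.AE_prob_1)
    moreover have "AE x in D. \<not> H x \<le> 0"
      using zero by (intro AE_I[of _ _ "{x. H x \<le> 0}"]) (auto simp: D.emeasure_eq_measure)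
    ultimately show ?thesis by eventually_elim auto
  qed
  have F01: "0 \<le> F y" "F y \<le> 1" for y
  proof -
    show "0 \<le> F y"
      by (rule tendsto_upperbound[OF F.bot]) (auto simp: eventually_at_bot_linorder intro: monoD[OF F.mono])
    show "F y \<le> 1"
      by (rule tendsto_lowerbound[OF F.top]) (auto simp: eventually_at_top_linorder intro: monoD[OF F.mono])
  qed
  have unif': "measure D {x. H x \<le> p} = p" if "0 \<le> p" "p \<le> 1" for p
  proof -
    have "measure D {x. H x \<le> 1} = 1"
      using D.prob_space D.cdf_bounded_prob by (simp add: H_def)
    then show ?thesis using that unif[of p] zero by (cases "p = 0"; cases "p = 1") auto
  qed
  \<comment> \<open>For \<open>H x = 0\<close> the set is unbounded below and for
    \<open>H x = 1\<close> it may be empty; these exceptional \<open>x\<close> have probability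
    0.\<close>
  define q where "q x = (if 0 < H x \<and> H x < 1 then Inf {y. H x \<le> F y} else 0)" for x
  have q_le: "q x \<le> y \<longleftrightarrow> (if 0 < H x \<and> H x < 1 then H x \<le> F y else 0 \<le> y)" for x y
    unfolding q_def using F.pseudoinverse[of "H x" y] by auto
  have qm[measurable]: "q \<in> borel_measurable borel"
    unfolding borel_measurable_iff_le q_le by measurable
  have "cdf (distr M borel (\<lambda>\<omega>. q (X \<omega>))) y = F y" for y
  proof -
    have "distr M borel (\<lambda>\<omega>. q (X \<omega>)) = distr D borel q"
      unfolding D_def by (subst distr_distr) (auto simp: comp_def)
    then have "cdf (distr M borel (\<lambda>\<omega>. q (X \<omega>))) y = measure D {x. q x \<le> y}"
      by (simp add: cdf_def measure_distr vimage_def)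
    also have "\<dots> = measure D {x. H x \<le> F y}"
    proof (rule D.finite_measure_eq_AE)
      show "AE x in D. x \<in> {x. q x \<le> y} \<longleftrightarrow> x \<in> {x. H x \<le> F y}"
        using ae by eventually_elim (simp add: q_le)
    qed auto
    also have "\<dots> = F y" by (rule unif'[OF F01])
    finally show ?thesis .
  qed
  then show thesis using that[OF qm] by blast
qed

section \<open>Gain of the quadratic strategy on one interval\<close>

text \<open>Discrete version of \<open>2 \<integral> (g - g(a)) dg = (g - g(a))\<^sup>2\<close>; the correction is the quadratic
  variation along the grid, negligible for paths of Hoelder order above \<open>1/2\<close>.\<close>

lemma quadratic_gain:
  fixes g :: "real \<Rightarrow> real" and p :: "nat \<Rightarrow> real"
  assumes p: "incseq p" and u: "p 0 \<le> u"
  shows "(\<Sum>i<N. 2 * c * (g (p i) - g (p 0)) * (g (min u (p (Suc i))) - g (min u (p i))))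
    = c * ((g (min u (p N)) - g (p 0))\<^sup>2 - (\<Sum>i<N. (g (min u (p (Suc i))) - g (min u (p i)))\<^sup>2))"
proof (induction N)
  case 0
  then show ?case using u by (simp add: min_absorb2)
next
  case (Suc N)
  \<comment> \<open>Before \<open>u\<close> this is 2 A B = (A + B)^2 - A^2 - B^2 for the
    displacement A and the next increment B; after \<open>u\<close> both capped points are
    \<open>u\<close> and everything vanishes.\<close>
  have step: "2 * c * (g (p N) - g (p 0)) * (g (min u (p (Suc N))) - g (min u (p N)))
    = c * ((g (min u (p (Suc N))) - g (p 0))\<^sup>2 - (g (min u (p N)) - g (p 0))\<^sup>2
        - (g (min u (p (Suc N))) - g (min u (p N)))\<^sup>2)"
  proof (cases "p N \<le> u")
    case True
    then show ?thesis by (simp add: min_absorb2 power2_eq_square algebra_simps)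
  next
    case False
    then have "min u (p N) = u" "min u (p (Suc N)) = u" using incseq_SucD[OF p, of N] by auto
    then show ?thesis by simp
  qed
  show ?case unfolding sum.lessThan_Suc Suc step by (simp add: algebra_simps)
qed

text \<open>Each of the \<open>N\<close> increments is at most C ((b - a) / N)^\<alpha>, so
  \<open>fine\<close> limits the quadratic variation term to 1. For \<open>u\<close> beyond
  \<open>b\<close> this says that a completed stage loses at most 1.\<close>

lemma quadratic_gain_lower_bound:
  fixes g :: "real \<Rightarrow> real"
  assumes g: "\<forall>s\<in>{0..1}. \<forall>t\<in>{0..1}. \<bar>g t - g s\<bar> \<le> C * \<bar>t - s\<bar> powr \<alpha>"
    and \<alpha>: "0 < \<alpha>" and c: "0 \<le> c" and ab: "0 \<le> a" "a \<le> b" "b \<le> 1" and N: "0 < N"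
    and u: "a \<le> u"
    and p: "\<And>i. p i = a + (b - a) * real i / real N"
    and fine: "c * (real N * (C * ((b - a) / real N) powr \<alpha>)\<^sup>2) \<le> 1"
  shows "(\<Sum>i<N. 2 * c * (g (p i) - g a) * (g (min u (p (Suc i))) - g (min u (p i)))) \<ge> c * (g (min u b) - g a)\<^sup>2 - 1"
proof -
  have C: "0 \<le> C" using g[rule_format, of 0 1] by simp
  have p0: "p 0 = a" and pN: "p N = b" using N by (auto simp: p)
  have step: "p (Suc i) - p i = (b - a) / real N" for i
    by (simp add: p add_divide_distrib[symmetric] diff_divide_distrib[symmetric] algebra_simps)
  have inc: "incseq p"
  proof (rule incseq_SucI)
    show "p i \<le> p (Suc i)" for i
      using step[of i] ab N divide_nonneg_nonneg[of "b - a" "real N"] by linarith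
  qed
  have range: "p i \<in> {0..1}" if "i \<le> N" for i
    using incseqD[OF inc, of 0 i] incseqD[OF inc, of i N] p0 pN ab that by auto
  have "(\<Sum>i<N. (g (min u (p (Suc i))) - g (min u (p i)))\<^sup>2) \<le> (\<Sum>i<N. (C * ((b - a) / real N) powr \<alpha>)\<^sup>2)"
  proof (rule sum_mono)
    fix i assume i: "i \<in> {..<N}"
    have "\<bar>g (min u (p (Suc i))) - g (min u (p i))\<bar> \<le> C * \<bar>min u (p (Suc i)) - min u (p i)\<bar> powr \<alpha>"
      using g u ab range[of i] range[of "Suc i"] i by auto
    also have "\<dots> \<le> C * ((b - a) / real N) powr \<alpha>"
      using step[of i] incseq_SucD[OF inc, of i] C \<alpha> by (intro mult_left_mono powr_mono2) auto
    finally have "\<bar>g (min u (p (Suc i))) - g (min u (p i))\<bar> \<le> \<bar>C * ((b - a) / real N) powr \<alpha>\<bar>" by simp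
    then show "(g (min u (p (Suc i))) - g (min u (p i)))\<^sup>2 \<le> (C * ((b - a) / real N) powr \<alpha>)\<^sup>2"
      by (simp only: abs_le_square_iff)
  qed
  then have "c * (\<Sum>i<N. (g (min u (p (Suc i))) - g (min u (p i)))\<^sup>2) \<le> c * (real N * (C * ((b - a) / real N) powr \<alpha>)\<^sup>2)"
    using c by (intro mult_left_mono) auto
  then show ?thesis
    using quadratic_gain[OF inc, where u=u and g=g and N=N and c=c] u fine unfolding p0 pN by (simp add: right_diff_distrib)
qed

text \<open>The expression is a constant times N^(1 - 2 \<alpha>), which tends to 0 because \<alpha>
  > 1/2.\<close>

lemma fine_grid_exists:
  fixes c C \<alpha> d :: real
  assumes "1 / 2 < \<alpha>" "0 \<le> d"
  shows "\<exists>N>0. c * (real N * (C * (d / real N) powr \<alpha>)\<^sup>2) \<le> 1"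
proof -
  have eq: "c * (real N * (C * (d / real N) powr \<alpha>)\<^sup>2) = c * C\<^sup>2 * (d powr \<alpha>)\<^sup>2 * real N powr (1 - 2 * \<alpha>)" if "0 < N" for N :: nat
  proof -
    have "real N powr (1 - 2 * \<alpha>) = real N / (real N powr \<alpha>)\<^sup>2"
      using that by (simp add: powr_diff power2_eq_square powr_add[symmetric])
    then show ?thesis using assms that by (simp add: powr_divide power_mult_distrib power_divide)
  qed
  have "((\<lambda>N. c * C\<^sup>2 * (d powr \<alpha>)\<^sup>2 * real N powr (1 - 2 * \<alpha>)) \<longlongrightarrow> c * C\<^sup>2 * (d powr \<alpha>)\<^sup>2 * 0) sequentially"
    using assms by (intro tendsto_intros tendsto_neg_powr filterlim_real_sequentially) auto
  then have "\<forall>\<^sub>F N in sequentially. c * C\<^sup>2 * (d powr \<alpha>)\<^sup>2 * real N powr (1 - 2 * \<alpha>) < 1"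
    by (intro order_tendstoD(2)) auto
  then have "\<forall>\<^sub>F N in sequentially. 0 < N \<and> c * C\<^sup>2 * (d powr \<alpha>)\<^sup>2 * real N powr (1 - 2 * \<alpha>) < 1"
    using eventually_gt_at_top[of 0] by eventually_elim auto
  then obtain N where "0 < N" "c * C\<^sup>2 * (d powr \<alpha>)\<^sup>2 * real N powr (1 - 2 * \<alpha>) < 1"
    by (auto dest: eventually_happens)
  then show ?thesis using eq[of N] by (intro exI[of _ N]) auto
qed

section \<open>Small ball probabilities\<close>

lemma small_radius_exists:
  fixes C d \<alpha> :: real
  assumes "0 < C" "0 < d" "0 < \<alpha>"
  shows "\<exists>\<epsilon>>0. \<epsilon> \<le> d powr \<alpha> \<and> exp (- (C * d * \<epsilon> powr (- 1 / \<alpha>))) \<le> 1 / (real n + 1)"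
proof -
  \<comment> \<open>The second entry makes C d e^(-1/\<alpha>) at least n + 1; then exp (n + 1)
    \<ge> n + 1 gives the claim.\<close>
  define e where "e = min (d powr \<alpha>) ((C * d / (real n + 1)) powr \<alpha>)"
  have e: "0 < e" "e \<le> d powr \<alpha>" using assms by (auto simp: e_def)
  have "((C * d / (real n + 1)) powr \<alpha>) powr (- 1 / \<alpha>) = (real n + 1) / (C * d)"
    using assms by (simp add: powr_powr powr_minus_divide[of _ 1, simplified])
  moreover have "((C * d / (real n + 1)) powr \<alpha>) powr (- 1 / \<alpha>) \<le> e powr (- 1 / \<alpha>)"
    using e assms by (intro powr_mono2') (auto simp: e_def)
  ultimately have "C * d * ((real n + 1) / (C * d)) \<le> C * d * e powr (- 1 / \<alpha>)"
    using assms by (intro mult_left_mono) auto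
  then have "real n + 1 \<le> C * d * e powr (- 1 / \<alpha>)" using assms by simp
  then have "exp (- (C * d * e powr (- 1 / \<alpha>))) \<le> exp (- (real n + 1))" by simp
  also have "\<dots> = 1 / exp (real n + 1)" by (simp only: exp_minus inverse_eq_divide)
  also have "\<dots> \<le> 1 / (real n + 1)"
    using exp_ge_add_one_self[of "real n + 1"] by (intro divide_left_mono) auto
  finally show ?thesis using e by blast
qed

text \<open>If \<open>f\<close> exceeded \<open>y\<close> at \<open>u\<close>,
  \<open>first_exit\<close> on [a,u] would produce a rational time of excess.\<close>

lemma bounded_on_rationals:
  fixes f :: "real \<Rightarrow> real"
  assumes cont: "continuous_on {a..b} f" and fa: "f a \<le> y" and rat: "\<And>q. q \<in> \<rat> \<Longrightarrow> q \<in> {a..b} \<Longrightarrow> f q \<le> y"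
    and u: "u \<in> {a..b}"
  shows "f u \<le> y"
proof (rule ccontr)
  assume "\<not> f u \<le> y"
  then have fu: "y < f u" by simp
  have au: "a \<le> u" using u by simp
  have contu: "continuous_on {a..u} f" using cont by (rule continuous_on_subset) (use u in auto)
  show False
  proof (rule first_exit[OF au contu fa fu])
    fix \<tau> assume \<tau>: "a \<le> \<tau>" and after: "\<And>t. \<tau> < t \<Longrightarrow> \<exists>q\<in>\<rat>. \<tau> < q \<and> q < t \<and> q \<le> u \<and> y < f q"
    have "\<tau> < \<tau> + 1" by simp
    from after[OF this] obtain q where "q \<in> \<rat>" "\<tau> < q" "q \<le> u" "y < f q" by blast
    then show False using rat[of q] u \<tau> by auto
  qed
qed

text \<open>Paths are continuous only almost surely, so the event with the supremum over all times
  is placed in the completion. Its rational version is an event of \<open>M\<close> and differs from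
  it by a null set.\<close>

lemma oscillation_event:
  fixes X :: "real \<Rightarrow> 'a \<Rightarrow> real"
  assumes M: "prob_space M" and X: "\<And>u. u \<in> {0..1} \<Longrightarrow> X u \<in> borel_measurable M"
    and hoelder: "AE \<omega> in M. \<forall>s\<in>{0..1}. \<forall>t\<in>{0..1}. \<bar>X t \<omega> - X s \<omega>\<bar> \<le> C * \<bar>t - s\<bar> powr \<alpha>"
    and \<alpha>: "0 < \<alpha>" and ab: "0 \<le> a" "a \<le> b" "b \<le> 1" and \<epsilon>: "0 \<le> \<epsilon>"
  defines "B \<equiv> {\<omega> \<in> space M. \<forall>q\<in>\<rat> \<inter> {a..b}. \<bar>X q \<omega> - X a \<omega>\<bar> \<le> \<epsilon>}"
  shows "B \<in> sets M"
    and "measure M B = measure (completion M) {\<omega> \<in> space M. (SUP u\<in>{a..b}. \<bar>X u \<omega> - X a \<omega>\<bar>) \<le> \<epsilon>}"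
proof -
  interpret prob_space M by fact
  let ?A = "{\<omega> \<in> space M. (SUP u\<in>{a..b}. \<bar>X u \<omega> - X a \<omega>\<bar>) \<le> \<epsilon>}"
  have "Measurable.pred M (\<lambda>\<omega>. \<forall>q\<in>\<rat> \<inter> {a..b}. \<bar>X q \<omega> - X a \<omega>\<bar> \<le> \<epsilon>)"
  proof (rule pred_Ball_countable)
    fix q assume "q \<in> \<rat> \<inter> {a..b}"
    then have [measurable]: "X q \<in> borel_measurable M" "X a \<in> borel_measurable M" using ab by (auto intro!: X)
    show "Measurable.pred M (\<lambda>\<omega>. \<bar>X q \<omega> - X a \<omega>\<bar> \<le> \<epsilon>)" by measurable
  qed (simp add: countable_rat countable_Int1)
  then show B: "B \<in> sets M" unfolding B_def pred_def .
  have "AE \<omega> in M. \<omega> \<in> B \<longleftrightarrow> \<omega> \<in> ?A"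
    using hoelder AE_space
  proof eventually_elim
    case (elim \<omega>)
    have cont: "continuous_on {a..b} (\<lambda>u. \<bar>X u \<omega> - X a \<omega>\<bar>)"
      using continuous_on_subset[OF continuous_on_hoelder[OF elim(1) \<alpha>], of "{a..b}"] ab
      by (intro continuous_intros) auto
    have bdd: "bdd_above ((\<lambda>u. \<bar>X u \<omega> - X a \<omega>\<bar>) ` {a..b})"
      using compact_continuous_image[OF cont compact_Icc] by (intro bounded_imp_bdd_above compact_imp_bounded)
    show ?case
    proof
      assume "\<omega> \<in> B"
      then have "\<bar>X u \<omega> - X a \<omega>\<bar> \<le> \<epsilon>" if "u \<in> {a..b}" for u
        \<comment> \<open>The left end \<open>a\<close> may be irrational, but there the
          displacement is 0 \<le> \<epsilon>.\<close>
        using \<epsilon> by (intro bounded_on_rationals[OF cont _ _ that]) (auto simp: B_def)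
      then show "\<omega> \<in> ?A" using elim(2) ab by (auto intro!: cSUP_least)
    next
      assume *: "\<omega> \<in> ?A"
      have "\<bar>X q \<omega> - X a \<omega>\<bar> \<le> \<epsilon>" if "q \<in> {a..b}" for q
        using cSUP_upper[OF that bdd] * by simp
      then show "\<omega> \<in> B" using elim(2) by (auto simp: B_def)
    qed
  qed
  then have ae: "AE \<omega> in completion M. \<omega> \<in> B \<longleftrightarrow> \<omega> \<in> ?A" by (rule AE_completion)
  have A: "?A \<in> sets (completion M)"
    by (rule completion.in_sets_AE[OF ae]) (use B in auto)
  show "measure M B = measure (completion M) ?A"
    using measure_eq_AE[OF ae _ A] B by simp
qed

section \<open>Choice of the stages and of the strategy\<close>

theorem theorem4p1:
  fixes M :: "'a measure" and \<F> :: "real \<Rightarrow> 'a measure"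
    and X :: "real \<Rightarrow> 'a \<Rightarrow> real"
    and \<alpha> \<delta> C1 C2 v :: real and F :: "real \<Rightarrow> real"
  assumes basis: "stochastic_basis M \<F>"
    and adapted: "adapted_process \<F> X"
    and constants: "\<alpha> > 1/2" "\<delta> > 0" "C1 > 0" "C2 > 0"
    and hoelder: "AE \<omega> in M. \<forall>s\<in>{0..1}. \<forall>t\<in>{0..1}.
        \<bar>X t \<omega> - X s \<omega>\<bar> \<le> C1 * \<bar>t - s\<bar> powr \<alpha>"
    and small_ball: "\<And>s t \<epsilon>. s \<in> {0..1} \<inter> {1 - \<delta>..1} \<Longrightarrow> t \<in> {0..1} \<inter> {1 - \<delta>..1} \<Longrightarrow>
        s < t \<Longrightarrow> 0 < \<epsilon> \<Longrightarrow> \<epsilon> \<le> (t - s) powr \<alpha> \<Longrightarrow>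
        measure (completion M) {\<omega> \<in> space M. (SUP u\<in>{s..t}. \<bar>X u \<omega> - X s \<omega>\<bar>) \<le> \<epsilon>}
          \<le> exp (- (C2 * (t - s) * \<epsilon> powr (- 1 / \<alpha>)))"
    and v: "v \<in> {0..1}" "1 - \<delta> < v" "v < 1"
    and continuous_distr: "continuous_on UNIV (cdf (distr M borel (X v)))"
    and F: "distribution_function F"
  shows "\<exists>\<phi> I. adapted_process \<F> \<phi> \<and> I \<in> borel_measurable M \<and>
           (AE \<omega> in M. has_gls_integral \<alpha> 0 1 (\<lambda>t. \<phi> t \<omega>) (\<lambda>t. X t \<omega>) (I \<omega>)) \<and>
           cdf (distr M borel I) = F"
proof -
  have \<alpha>: "0 < \<alpha>" using constants by simp
  interpret prob_space M using basis by (simp add: stochastic_basis_def)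
  have sub: "f \<in> borel_measurable (\<F> t) \<Longrightarrow> f \<in> borel_measurable M" if "t \<in> {0..1}" for t and f :: "'a \<Rightarrow> real"
  proof (rule measurable_from_subalg)
    show "subalgebra M (\<F> t)" using basis that by (simp add: stochastic_basis_def)
  qed
  have XF: "X t \<in> borel_measurable (\<F> t)" if "t \<in> {0..1}" for t
    using adapted that by (simp add: adapted_process_def)
  have XM: "X t \<in> borel_measurable M" if "t \<in> {0..1}" for t using sub[OF that XF[OF that]] .
  obtain q where q: "q \<in> borel_measurable borel" "cdf (distr M borel (\<lambda>\<omega>. q (X v \<omega>))) = F"
    using quantile_transform[OF prob_space_axioms XM[OF v(1)] continuous_distr F] .
  define \<xi> where "\<xi> \<omega> = q (X v \<omega>)" for \<omega>
  \<comment> \<open>The stages start at \<open>v\<close>, where \<xi> is known, and increase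
    strictly to 1. All lie beyond 1 - \<delta>, where the small ball estimate is available.\<close>
  define s where "s n = 1 - (1 - v) / (real n + 1)" for n
  have s0: "s 0 = v" by (simp add: s_def)
  have s_less: "s n < 1" for n using v by (simp add: s_def)
  have s_step: "s n < s (Suc n)" for n
    unfolding s_def using v by (intro diff_strict_left_mono divide_strict_left_mono) auto
  have "incseq s" by (rule incseq_SucI) (rule less_imp_le[OF s_step])
  then have s_mono: "m \<le> n \<Longrightarrow> s m \<le> s n" for m n by (rule incseqD)
  have s_ge: "v \<le> s n" for n using s_mono[of 0 n] s0 by simp
  have s01: "s n \<in> {0..1}" for n using s_ge[of n] s_less[of n] v by auto
  have cofinal: "\<exists>m. t \<le> s m" if "t < 1" for t
  proof -
    obtain m where "(1 - v) / (1 - t) < real m" using reals_Archimedean2 by blast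
    then have "(1 - v) / (real m + 1) \<le> 1 - t" using that v by (simp add: field_simps)
    then show ?thesis by (intro exI[of _ m]) (simp add: s_def)
  qed
  define d where "d n = s (Suc n) - s n" for n
  have d: "0 < d n" for n using s_step by (simp add: d_def)
  have "\<exists>\<epsilon>>0. \<epsilon> \<le> d n powr \<alpha> \<and> exp (- (C2 * d n * \<epsilon> powr (- 1 / \<alpha>))) \<le> 1 / (real n + 1)" for n
    by (rule small_radius_exists) (use constants d \<alpha> in auto)
  then obtain \<epsilon> where \<epsilon>: "\<And>n. 0 < \<epsilon> n" "\<And>n. \<epsilon> n \<le> d n powr \<alpha>"
    "\<And>n. exp (- (C2 * d n * \<epsilon> n powr (- 1 / \<alpha>))) \<le> 1 / (real n + 1)" by metis
  \<comment> \<open>A stage in which \<open>X\<close> moves by more than \<open>\<epsilon> n\<close> then gains at least \<open>2 n\<close>, which outweighs the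
    losses of at most \<open>1\<close> in each of the \<open>n\<close> earlier stages.\<close>
  define c where "c n = (2 * real n + 1) / (\<epsilon> n)\<^sup>2" for n
  have c: "0 \<le> c n" for n by (simp add: c_def)
  \<comment> \<open>The mesh is chosen after \<open>c n\<close>, however large, so that stage
    \<open>n\<close> loses at most 1.\<close>
  have "\<exists>N>0. c n * (real N * (C1 * (d n / real N) powr \<alpha>)\<^sup>2) \<le> 1" for n
    by (rule fine_grid_exists) (use constants d[of n] in auto)
  then obtain N :: "nat \<Rightarrow> nat" where N: "\<And>n. 0 < N n"
    "\<And>n. c n * (real (N n) * (C1 * (d n / real (N n)) powr \<alpha>)\<^sup>2) \<le> 1" by metis
  define p where "p n i = s n + d n * real i / real (N n)" for n i
  have p_range: "s n \<le> p n i" "p n i \<le> p n (Suc i)" for n i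
    using d[of n] N(1)[of n] by (auto simp: p_def intro!: divide_right_mono)
  have p_le: "p n i \<le> s (Suc n)" if "i \<le> N n" for n i
  proof -
    have "d n * real i / real (N n) \<le> d n" using d[of n] N(1)[of n] that by (simp add: pos_divide_le_eq)
    then show ?thesis by (simp add: p_def d_def)
  qed
  \<comment> \<open>The pair (n, i) stands for grid interval i of stage n; \<open>K m\<close>
    collects the stages before \<open>m\<close>.\<close>
  define K where "K m = Sigma {..<m} (\<lambda>n. {..<N n})" for m
  define l where "l k = p (fst k) (snd k)" for k
  define r where "r k = p (fst k) (Suc (snd k))" for k
  define w where "w k \<omega> = 2 * c (fst k) * (X (l k) \<omega> - X (s (fst k)) \<omega>)" for k \<omega>
  interpret interval_grid s K l r
  proof
    show "finite (K m)" for m by (simp add: K_def)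
    show "m \<le> n \<Longrightarrow> K m \<subseteq> K n" for m n by (auto simp: K_def)
    show "s 0 \<le> l k \<and> l k \<le> r k \<and> r k \<le> s m" if kK: "k \<in> K m" for k m
    proof -
      obtain n i where k: "k = (n, i)" "n < m" "i < N n" using kK by (cases k) (auto simp: K_def)
      have "r k \<le> s (Suc n)" "s (Suc n) \<le> s m" "s 0 \<le> s n"
        using k p_le[of "Suc i" n] s_mono by (auto simp: r_def)
      then show ?thesis using p_range[of n i] k by (simp add: l_def r_def)
    qed
    show "s m \<le> l k" if kK: "k \<in> K n" "k \<notin> K m" for k n m
    proof -
      obtain j i where k: "k = (j, i)" "m \<le> j" using kK by (cases k) (auto simp: K_def)
      then show ?thesis using p_range(1)[of j i] s_mono[of m j] by (simp add: l_def)
    qed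
    show "0 \<le> s 0" using s01[of 0] by simp
  qed (use s_less cofinal in auto)
  have wF: "w k \<in> borel_measurable (\<F> (l k))" if k: "k \<in> K m" for k m
  proof -
    have "l k \<in> {0..1}" using K_bounds[OF k] by auto
    moreover have "s (fst k) \<le> l k" by (simp add: l_def p_range)
    ultimately have "X (s (fst k)) \<in> borel_measurable (\<F> (l k))" "X (l k) \<in> borel_measurable (\<F> (l k))"
      by (rule stochastic_basis_measurable_mono[OF basis s01 _ _ XF[OF s01]]) (rule XF, fact)
    then show ?thesis unfolding w_def[abs_def] by measurable
  qed
  have \<xi>F: "\<xi> \<in> borel_measurable (\<F> (s 0))"
    unfolding \<xi>_def[abs_def] s0 using measurable_compose[OF XF[OF v(1)] q(1)] .
  have gain: "real n \<le> gain (Suc n) (\<lambda>k. w k \<omega>) (\<lambda>t. X t \<omega>) u"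
    if h: "\<forall>s\<in>{0..1}. \<forall>t\<in>{0..1}. \<bar>X t \<omega> - X s \<omega>\<bar> \<le> C1 * \<bar>t - s\<bar> powr \<alpha>"
      and u: "u \<in> {s n..s (Suc n)}" "\<epsilon> n < \<bar>X u \<omega> - X (s n) \<omega>\<bar>" for n \<omega> u
  proof -
    \<comment> \<open>\<open>G j\<close> is the contribution of stage \<open>j\<close> by time
      \<open>u\<close>: the stages before \<open>n\<close> are complete, stage \<open>n\<close> is
      running.\<close>
    define G where "G j = (\<Sum>i<N j. 2 * c j * (X (p j i) \<omega> - X (s j) \<omega>) * (X (min u (p j (Suc i))) \<omega> - X (min u (p j i)) \<omega>))" for j
    have low: "c j * (X (min u (s (Suc j))) \<omega> - X (s j) \<omega>)\<^sup>2 - 1 \<le> G j" if "j \<le> n" for j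
      unfolding G_def
    proof (rule quadratic_gain_lower_bound[OF h \<alpha> c])
      show "s j \<le> u" using s_mono[OF that] u by simp
    qed (use s01[of j] s01[of "Suc j"] s_step[of j] N[of j] in \<open>auto simp: p_def d_def\<close>)
    have "-1 \<le> G j" if "j < n" for j
    proof -
      have "0 \<le> c j * (X (min u (s (Suc j))) \<omega> - X (s j) \<omega>)\<^sup>2" using c by simp
      then show ?thesis using low[of j] that by simp
    qed
    then have "(\<Sum>j<n. -1) \<le> (\<Sum>j<n. G j)" by (intro sum_mono) auto
    moreover have "2 * real n \<le> G n"
    proof -
      have "(\<epsilon> n)\<^sup>2 \<le> (X u \<omega> - X (s n) \<omega>)\<^sup>2"
        using u(2) \<epsilon>(1)[of n] by (intro abs_le_square_iff[THEN iffD1]) auto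
      then have "c n * (\<epsilon> n)\<^sup>2 \<le> c n * (X u \<omega> - X (s n) \<omega>)\<^sup>2" using c by (rule mult_left_mono)
      moreover have "c n * (\<epsilon> n)\<^sup>2 = 2 * real n + 1" using \<epsilon>(1)[of n] by (simp add: c_def)
      moreover have "min u (s (Suc n)) = u" using u by auto
      ultimately show ?thesis using low[of n] by simp
    qed
    moreover have "gain (Suc n) (\<lambda>k. w k \<omega>) (\<lambda>t. X t \<omega>) u = (\<Sum>j<Suc n. G j)"
      unfolding gain_def K_def G_def w_def l_def r_def by (subst sum.Sigma) (auto simp: case_prod_beta)
    ultimately show ?thesis by simp
  qed
  define B where "B n = {\<omega> \<in> space M. \<forall>q\<in>\<rat> \<inter> {s n..s (Suc n)}. \<bar>X q \<omega> - X (s n) \<omega>\<bar> \<le> \<epsilon> n}" for n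
  have B: "B n \<in> sets M" "measure M (B n) \<le> 1 / (real n + 1)" for n
  proof -
    have *: "0 \<le> s n" "s n \<le> s (Suc n)" "s (Suc n) \<le> 1" "0 \<le> \<epsilon> n"
      using s01[of n] s01[of "Suc n"] s_step[of n] \<epsilon>(1)[of n] by auto
    have osc: "B n \<in> sets M" "measure M (B n)
        = measure (completion M) {\<omega> \<in> space M. (SUP u\<in>{s n..s (Suc n)}. \<bar>X u \<omega> - X (s n) \<omega>\<bar>) \<le> \<epsilon> n}"
      unfolding B_def by (rule oscillation_event[OF prob_space_axioms XM hoelder \<alpha> *], assumption)+
    show "B n \<in> sets M" by (rule osc(1))
    have "measure M (B n) \<le> exp (- (C2 * (s (Suc n) - s n) * \<epsilon> n powr (- 1 / \<alpha>)))"
      unfolding osc(2) using s01[of n] s01[of "Suc n"] s_ge[of n] s_ge[of "Suc n"] v s_step[of n] \<epsilon>(1,2)[of n]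
      by (intro small_ball) (auto simp: d_def)
    also have "\<dots> \<le> 1 / (real n + 1)" using \<epsilon>(3)[of n] by (simp add: d_def)
    finally show "measure M (B n) \<le> 1 / (real n + 1)" .
  qed
  have "AE \<omega> in M. \<exists>n\<ge>j. \<omega> \<notin> B n" for j
  proof -
    \<comment> \<open>\<open>E\<close> lies in every \<open>B n\<close> with n \<ge> j, and their
      probabilities tend to 0, so \<open>E\<close> is null.\<close>
    define E where "E = (\<Inter>n\<in>{j..}. B n)"
    have E: "E \<in> sets M" unfolding E_def using B(1) by (intro sets.countable_INT') auto
    have "measure M E \<le> 0"
    proof (rule LIMSEQ_le_const)
      show "(\<lambda>n. 1 / (real n + 1)) \<longlonglongrightarrow> 0"
        using LIMSEQ_inverse_real_of_nat by (simp add: inverse_eq_divide add.commute)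
      have "measure M E \<le> 1 / (real n + 1)" if "j \<le> n" for n
      proof -
        have "measure M E \<le> measure M (B n)" using B(1) that by (intro finite_measure_mono) (auto simp: E_def)
        then show ?thesis using B(2)[of n] by simp
      qed
      then show "\<exists>N. \<forall>n\<ge>N. measure M E \<le> 1 / (real n + 1)" by blast
    qed
    then have "E \<in> null_sets M" using E measure_nonneg[of M E] by (auto simp: null_sets_def emeasure_eq_measure)
    then have "AE \<omega> in M. \<omega> \<notin> E" by (rule AE_not_in)
    then show ?thesis by eventually_elim (auto simp: E_def)
  qed
  then have "AE \<omega> in M. \<forall>j. \<exists>n\<ge>j. \<omega> \<notin> B n" by (simp add: AE_all_countable)
  then have reach: "AE \<omega> in M. \<exists>m. \<exists>u\<in>{s 0..s m}. \<bar>\<xi> \<omega>\<bar> < gain m (\<lambda>k. w k \<omega>) (\<lambda>t. X t \<omega>) u"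
    using hoelder AE_space
  proof eventually_elim
    case (elim \<omega>)
    obtain j where j: "\<bar>\<xi> \<omega>\<bar> < real j" using reals_Archimedean2 by blast
    obtain n where n: "j \<le> n" "\<omega> \<notin> B n" using elim(1) by blast
    then obtain u where u: "u \<in> {s n..s (Suc n)}" "\<epsilon> n < \<bar>X u \<omega> - X (s n) \<omega>\<bar>"
      using elim(3) by (auto simp: B_def not_le)
    have "\<bar>\<xi> \<omega>\<bar> < gain (Suc n) (\<lambda>k. w k \<omega>) (\<lambda>t. X t \<omega>) u"
      using j n(1) gain[OF elim(2) u] by linarith
    moreover have "u \<in> {s 0..s (Suc n)}" using u(1) s_mono[of 0 n] by auto
    ultimately show ?case by blast
  qed
  have "\<exists>\<phi>. adapted_process \<F> \<phi> \<and>
     (AE \<omega> in M. has_gls_integral \<alpha> 0 1 (\<lambda>t. \<phi> t \<omega>) (\<lambda>t. X t \<omega>) (\<xi> \<omega>))"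
    by (rule attain_random_variable[OF basis adapted hoelder \<alpha> wF \<xi>F reach], assumption)
  then obtain \<phi> where "adapted_process \<F> \<phi>"
    "AE \<omega> in M. has_gls_integral \<alpha> 0 1 (\<lambda>t. \<phi> t \<omega>) (\<lambda>t. X t \<omega>) (\<xi> \<omega>)"
    by blast
  moreover have "\<xi> \<in> borel_measurable M" using sub[OF s01 \<xi>F] .
  moreover have "cdf (distr M borel \<xi>) = F" using q(2) unfolding \<xi>_def[abs_def] .
  ultimately show ?thesis by blast
qed

end
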